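(* Let $l_1,l_2,l_3$ be positive integers with $l_1=\min\{l_1,l_2,l_3\}$, $l_2\ge 2$ and $l_3\ge 2$, and let $G=\Theta(l_1,l_2,l_3)$. Then $G$ is not enumeratively chromatic-choosable if and only if $l_1,l_2,l_3$ all have the same parity and $\{l_1,l_2,l_3\}\neq\{2\}$.
   Context: All graphs are finite and simple. For positive integers $l_1,l_2,l_3$, the theta graph $\Theta(l_1,l_2,l_3)$ consists of two end vertices joined by three internally disjoint paths of lengths (numbers of edges) $l_1,l_2,l_3$. A list assignment $L$ for a graph $G$ assigns to each vertex $v$ a set $L(v)$ of colors; it is an $m$-assignment if $|L(v)|=m$ for all $v$. A proper $L$-coloring is a proper coloring $f$ with $f(v)\in L(v)$ for all $v$, and $P(G,L)$ is the number of proper $L$-colorings. For $m\in\mathbb{N}$, the chromatic polynomial $P(G,m)$ is the number of proper colorings of $G$ with colors from $\{1,\dots,m\}$, and the list color function $P_\ell(G,m)$ is the minimum of $P(G,L)$ over all $m$-assignments $L$ for $G$. A graph $G$ is enumeratively chromatic-choosable if $P_\ell(G,m)=P(G,m)$ for every $m\in\mathbb{N}$. *)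

theory Defs
  imports Main
begin

definition simple_graph :: "'v set \<Rightarrow> ('v \<Rightarrow> 'v \<Rightarrow> bool) \<Rightarrow> bool" where
  "simple_graph V E \<longleftrightarrow> finite V \<and> (\<forall>u v. E u v \<longrightarrow> E v u) \<and> (\<forall>v. \<not> E v v)
     \<and> (\<forall>u v. E u v \<longrightarrow> u \<in> V \<and> v \<in> V)"

definition proper_L_colorings ::
  "'v set \<Rightarrow> ('v \<Rightarrow> 'v \<Rightarrow> bool) \<Rightarrow> ('v \<Rightarrow> nat set) \<Rightarrow> ('v \<Rightarrow> nat) set" where
  "proper_L_colorings V E L =
     {f. (\<forall>v\<in>V. f v \<in> L v) \<and> (\<forall>v. v \<notin> V \<longrightarrow> f v = undefined)
         \<and> (\<forall>u\<in>V. \<forall>v\<in>V. E u v \<longrightarrow> f u \<noteq> f v)}"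

definition num_L_colorings :: "'v set \<Rightarrow> ('v \<Rightarrow> 'v \<Rightarrow> bool) \<Rightarrow> ('v \<Rightarrow> nat set) \<Rightarrow> nat" where
  "num_L_colorings V E L = card (proper_L_colorings V E L)"

definition m_assignment :: "'v set \<Rightarrow> nat \<Rightarrow> ('v \<Rightarrow> nat set) \<Rightarrow> bool" where
  "m_assignment V m L \<longleftrightarrow> (\<forall>v\<in>V. finite (L v) \<and> card (L v) = m)"

definition chrom_poly :: "'v set \<Rightarrow> ('v \<Rightarrow> 'v \<Rightarrow> bool) \<Rightarrow> nat \<Rightarrow> nat" where
  "chrom_poly V E m = num_L_colorings V E (\<lambda>_. {1..m})"

definition list_color_fun :: "'v set \<Rightarrow> ('v \<Rightarrow> 'v \<Rightarrow> bool) \<Rightarrow> nat \<Rightarrow> nat" where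
  "list_color_fun V E m = Min {num_L_colorings V E L | L. m_assignment V m L}"

definition enum_chromatic_choosable :: "'v set \<Rightarrow> ('v \<Rightarrow> 'v \<Rightarrow> bool) \<Rightarrow> bool" where
  "enum_chromatic_choosable V E \<longleftrightarrow> (\<forall>m::nat. list_color_fun V E m = chrom_poly V E m)"

text \<open>Theta graph \<Theta>(l1,l2,l3).  End vertices (0,0) and (0,1); the internal vertices of
  path i (i = 1,2,3, of length l_i) are (i,1), ..., (i, l_i - 1).\<close>

definition theta_len :: "nat \<Rightarrow> nat \<Rightarrow> nat \<Rightarrow> nat \<Rightarrow> nat" where
  "theta_len l1 l2 l3 i = (if i = 1 then l1 else if i = 2 then l2 else l3)"

definition theta_pv :: "nat \<Rightarrow> nat \<Rightarrow> nat \<Rightarrow> nat \<Rightarrow> nat \<Rightarrow> nat \<times> nat" where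
  "theta_pv l1 l2 l3 i j =
     (if j = 0 then (0,0) else if j = theta_len l1 l2 l3 i then (0,1) else (i,j))"

definition theta_V :: "nat \<Rightarrow> nat \<Rightarrow> nat \<Rightarrow> (nat \<times> nat) set" where
  "theta_V l1 l2 l3 = {(0,0), (0,1)} \<union>
     {(i,j). i \<in> {1,2,3} \<and> 0 < j \<and> j < theta_len l1 l2 l3 i}"

definition theta_E :: "nat \<Rightarrow> nat \<Rightarrow> nat \<Rightarrow> nat \<times> nat \<Rightarrow> nat \<times> nat \<Rightarrow> bool" where
  "theta_E l1 l2 l3 x y \<longleftrightarrow> (\<exists>i\<in>{1,2,3}. \<exists>j < theta_len l1 l2 l3 i.
       (x = theta_pv l1 l2 l3 i j \<and> y = theta_pv l1 l2 l3 i (Suc j)) \<or>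
       (y = theta_pv l1 l2 l3 i j \<and> x = theta_pv l1 l2 l3 i (Suc j)))"

end

theory Submission
  imports Defs "HOL-Library.FuncSet"
begin

text \<open>
  Summing over the colors a, b of the two end vertices, the number of colorings is the sum of
  the products N1 N2 N3, where Ni counts the colorings of the i-th path with ends a, b.
  For the constant m-assignment, a path of length l has N = p + (-1)^l [a = b] with
  m p = (m - 1)^l - (-1)^l.  For arbitrary lists still N >= p if l is even and N >= p - 1
  if l is odd, and every color that does not survive along the whole path increases the total
  number of colorings of the path.  For m >= 3 and two even paths this excess
  outweighs the lost diagonal terms.  If two paths are odd, they form an even cycle, which can
  be cut again into two even paths, and the third path is even.  The lengths 2, 2, 2 are
  treated by the same estimate, except for m = 2.

  If all lengths have the same parity, then there are two colorings for m = 2.  Repeating the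
  list of an end vertex twice at the start of a path does not change the counts, so it suffices
  to have 2-assignments with fewer colorings for the lengths 1, 3, 3 and 2, 2, 4.
\<close>

section \<open>Colorings of a path with prescribed ends\<close>

text \<open>\<open>As\<close> and \<open>xs\<close> belong to the internal vertices only, so a path
  of length \<open>l\<close> has \<open>l - 1\<close> lists; the end colors \<open>a\<close> and
  \<open>b\<close> are parameters.\<close>

definition path_colorings :: "nat \<Rightarrow> nat set list \<Rightarrow> nat \<Rightarrow> nat list set" where
  "path_colorings a As b = {xs. list_all2 (\<in>) xs As \<and> successively (\<noteq>) (a # xs @ [b])}"

definition num_path :: "nat \<Rightarrow> nat set list \<Rightarrow> nat \<Rightarrow> int" where
  "num_path a As b = int (card (path_colorings a As b))"

definition uniform_lists :: "nat \<Rightarrow> nat set list \<Rightarrow> bool" where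
  "uniform_lists m As \<longleftrightarrow> (\<forall>A\<in>set As. finite A \<and> card A = m)"

lemma uniform_lists_simps [simp]:
  "uniform_lists m []"
  "uniform_lists m (A # As) \<longleftrightarrow> finite A \<and> card A = m \<and> uniform_lists m As"
  "uniform_lists m (As @ Bs) \<longleftrightarrow> uniform_lists m As \<and> uniform_lists m Bs"
  by (auto simp: uniform_lists_def)

lemma path_colorings_Nil: "path_colorings a [] b = (if a \<noteq> b then {[]} else {})"
  by (auto simp: path_colorings_def)

lemma path_colorings_Cons:
  "path_colorings a (A # As) b = (\<Union>c\<in>A - {a}. (#) c ` path_colorings c As b)"
  by (auto simp: path_colorings_def list_all2_Cons2 image_iff)

lemma finite_path_colorings: "uniform_lists m As \<Longrightarrow> finite (path_colorings a As b)"
  by (induction As arbitrary: a) (auto simp: path_colorings_Nil path_colorings_Cons)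

lemma num_path_Nil [simp]: "num_path a [] b = of_bool (a \<noteq> b)"
  by (simp add: num_path_def path_colorings_Nil)

lemma num_path_nonneg [simp]: "0 \<le> num_path a As b"
  by (simp add: num_path_def)

lemma num_path_Cons:
  assumes "finite A" "uniform_lists m As"
  shows "num_path a (A # As) b = (\<Sum>c\<in>A - {a}. num_path c As b)"
proof -
  have "card (\<Union>c\<in>A - {a}. (#) c ` path_colorings c As b) =
      (\<Sum>c\<in>A - {a}. card ((#) c ` path_colorings c As b))"
    using assms by (intro card_UN_disjoint) (auto intro: finite_path_colorings)
  then show ?thesis
    by (simp add: num_path_def path_colorings_Cons card_image)
qed

lemma num_path_single: "finite A \<Longrightarrow> num_path a [A] b = int (card (A - {a, b}))"
  by (subst num_path_Cons[where m = 0]) (auto simp: sum.If_cases of_bool_def Diff_insert2[symmetric] Int_def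
      simp flip: Collect_neg_eq intro!: arg_cong[where f = card])

lemma sum_minus_singleton:
  fixes f :: "'a \<Rightarrow> int"
  assumes "finite A"
  shows "(\<Sum>x\<in>A - {a}. f x) = (\<Sum>x\<in>A. of_bool (x \<noteq> a) * f x)"
  by (rule sum.mono_neutral_cong_left) (use assms in auto)

lemma num_path_Cons':
  assumes "finite A" "uniform_lists m As"
  shows "num_path a (A # As) b = (\<Sum>c\<in>A. of_bool (c \<noteq> a) * num_path c As b)"
  using assms by (simp add: num_path_Cons sum_minus_singleton)

lemma sum_of_bool_neq:
  assumes "finite A"
  shows "(\<Sum>x\<in>A. of_bool (x \<noteq> a)) = int (card A) - of_bool (a \<in> A)"
proof -
  have "(\<Sum>x\<in>A. of_bool (x \<noteq> a)) = (\<Sum>x\<in>A - {a}. (1::int))"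
    using sum_minus_singleton[of A "\<lambda>_. 1" a] assms by simp
  then show ?thesis
    using assms card_gt_0_iff[of A] by (auto simp: card_Diff_singleton_if of_nat_diff Suc_leI)
qed

text \<open>Once the second internal vertex has color \<open>e\<close>, the first one may take any
  color of \<open>A\<close> except \<open>a\<close> and \<open>e\<close>.\<close>

lemma num_path_Cons_Cons:
  assumes "finite A" "finite B" "uniform_lists m As"
  shows "num_path a (A # B # As) b = (\<Sum>e\<in>B. int (card (A - {a, e})) * num_path e As b)"
proof -
  have "num_path a (A # B # As) b =
      (\<Sum>c\<in>A - {a}. \<Sum>e\<in>B. of_bool (e \<noteq> c) * num_path e As b)"
  proof -
    \<comment> \<open>\<open>B\<close> and the lists in \<open>As\<close> may differ in size, so
      \<open>num_path_Cons\<close> does not apply to \<open>B # As\<close> and the disjoint union is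
      counted directly.\<close>
    have "finite (path_colorings c (B # As) b)" for c
      using assms by (auto simp: path_colorings_Cons intro: finite_path_colorings)
    then have "card (\<Union>c\<in>A - {a}. (#) c ` path_colorings c (B # As) b) =
        (\<Sum>c\<in>A - {a}. card ((#) c ` path_colorings c (B # As) b))"
      using assms by (intro card_UN_disjoint) auto
    then have "num_path a (A # B # As) b = (\<Sum>c\<in>A - {a}. num_path c (B # As) b)"
      unfolding num_path_def path_colorings_Cons[of a A] by (simp add: card_image)
    then show ?thesis using assms by (simp add: num_path_Cons')
  qed
  also have "\<dots> = (\<Sum>e\<in>B. (\<Sum>c\<in>A - {a}. of_bool (e \<noteq> c)) * num_path e As b)"
    by (subst sum.swap) (simp add: sum_distrib_right)
  also have "\<dots> = (\<Sum>e\<in>B. int (card (A - {a, e})) * num_path e As b)"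
  proof (rule sum.cong)
    fix e
    have "(\<Sum>c\<in>A - {a}. of_bool (e \<noteq> c)) = (\<Sum>c\<in>A - {a} - {e}. 1::int)"
      by (rule sum.mono_neutral_cong_right) (use assms in auto)
    also have "A - {a} - {e} = A - {a, e}" by blast
    finally show "(\<Sum>c\<in>A - {a}. of_bool (e \<noteq> c)) * num_path e As b
        = int (card (A - {a, e})) * num_path e As b" by simp
  qed simp
  finally show ?thesis .
qed

section \<open>Bounds for the number of path colorings\<close>

text \<open>The number of colorings of a path of length \<open>l\<close> from a constant list of
  size \<open>m\<close> with two fixed distinct end colors: of the \<open>(m - 1) ^ l\<close> ways
  to take \<open>l\<close> steps from one end color, those that arrive at the other end color cannot
  be extended by it. The recursion avoids division by \<open>m\<close>.\<close>

fun offdiag :: "nat \<Rightarrow> nat \<Rightarrow> int" where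
  "offdiag m 0 = 0"
| "offdiag m (Suc l) = (int m - 1) ^ l - offdiag m l"

lemma one_le_mult_int:
  fixes a b :: int
  shows "1 \<le> a \<Longrightarrow> 1 \<le> b \<Longrightarrow> 1 \<le> a * b"
  using mult_mono[of 1 a 1 b] by simp

text \<open>Replaces powers of \<open>m - 1\<close> by polynomials in \<open>m\<close> and
  \<open>offdiag\<close>, so that the final comparisons become polynomial inequalities.\<close>

lemma offdiag_mult: "int m * offdiag m l = (int m - 1) ^ l - (- 1) ^ l"
  by (induction l) (auto simp: algebra_simps)

text \<open>Has the shape of the two-step bound for paths, so inductions that remove two vertices at
  a time close.\<close>

lemma offdiag_Suc_Suc: "offdiag m (Suc (Suc l)) = (int m - 2) * (int m - 1) ^ l + offdiag m l"
  by (simp add: algebra_simps)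

lemma offdiag_nonneg: "m \<ge> 2 \<Longrightarrow> offdiag m l \<ge> 0"
proof (induction l rule: induct_nat_012)
  case (ge2 l)
  then show ?case by (simp add: offdiag_Suc_Suc del: offdiag.simps)
qed auto

lemma offdiag_pos:
  assumes "m \<ge> 3" "l \<ge> 1"
  shows "offdiag m l \<ge> 1"
proof -
  consider "l = 1" | k where "l = Suc (Suc k)"
    using assms(2) by (metis One_nat_def Suc_le_D old.nat.exhaust)
  then show ?thesis
  proof cases
    case 2
    have "1 \<le> (int m - 2) * (int m - 1) ^ k"
      using assms mult_mono[of 1 "int m - 2" 1 "(int m - 1) ^ k"] by simp
    then show ?thesis using 2 offdiag_nonneg[of m k] assms by (simp add: offdiag_Suc_Suc del: offdiag.simps)
  qed auto
qed

text \<open>Colored one after the other, each internal vertex and finally the end with list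
  \<open>V\<close> has at least \<open>m - 1\<close> colors that differ from its
  predecessor.\<close>

lemma sum_num_path_right:
  assumes "m \<ge> 1" "uniform_lists m As" "finite V" "card V = m"
  shows "(\<Sum>b\<in>V. num_path a As b) \<ge> (int m - 1) ^ Suc (length As)"
  using assms(2)
proof (induction As arbitrary: a)
  case Nil
  then show ?case using assms sum_of_bool_neq[of V a] by (simp add: neq_commute)
next
  case (Cons A As)
  have "(int m - 1) * (int m - 1) ^ Suc (length As) \<le> (\<Sum>c\<in>A - {a}. (int m - 1) ^ Suc (length As))"
    using Cons.prems assms
    by (auto simp: card_Diff_singleton_if of_nat_diff intro!: mult_right_mono)
  also have "\<dots> \<le> (\<Sum>c\<in>A - {a}. \<Sum>b\<in>V. num_path c As b)"
    using Cons by (intro sum_mono) auto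
  also have "\<dots> = (\<Sum>b\<in>V. num_path a (A # As) b)"
    using Cons.prems by (subst sum.swap) (simp add: num_path_Cons[where m = m])
  finally show ?case by simp
qed

text \<open>The same count from the other end. As lists are removed at the left, the next list
  \<open>A\<close> takes the role of \<open>U\<close> in the induction, and each of its colors is
  compatible with at least \<open>m - 1\<close> colors of \<open>U\<close>.\<close>

lemma sum_num_path_left:
  assumes "m \<ge> 1" "uniform_lists m As" "finite U" "card U = m"
  shows "(\<Sum>a\<in>U. num_path a As b) \<ge> (int m - 1) ^ Suc (length As)"
  using assms(2-)
proof (induction As arbitrary: U)
  case Nil
  then show ?case using sum_of_bool_neq[of U b] by simp
next
  case (Cons A As)
  have ge: "(\<Sum>a\<in>U. of_bool (c \<noteq> a)) \<ge> int m - 1" for c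
    using sum_of_bool_neq[of U c] Cons.prems by (simp add: neq_commute)
  have "(int m - 1) * (int m - 1) ^ Suc (length As) \<le> (int m - 1) * (\<Sum>c\<in>A. num_path c As b)"
    using Cons assms(1) by (intro mult_left_mono) auto
  also have "\<dots> \<le> (\<Sum>c\<in>A. (\<Sum>a\<in>U. of_bool (c \<noteq> a)) * num_path c As b)"
    unfolding sum_distrib_left using Cons.prems
    by (intro sum_mono mult_right_mono ge) simp
  also have "\<dots> = (\<Sum>a\<in>U. num_path a (A # As) b)"
    using Cons.prems by (subst sum_distrib_right, subst sum.swap) (simp add: num_path_Cons'[where m = m])
  finally show ?case by simp
qed

text \<open>The factor card (A - {a, e}) in the two-step recursion is at least m - 2,
  and one end e contributes an additional summand as soon as it is at least m - 1.\<close>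

lemma num_path_Cons_Cons_ge:
  assumes "m \<ge> 2" "finite A" "card A = m" "finite B" "card B = m" "uniform_lists m As"
    and "e \<in> B" "card (A - {a, e}) \<ge> m - 1"
  shows "num_path a (A # B # As) b \<ge>
    (int m - 2) * (int m - 1) ^ Suc (length As) + num_path e As b"
proof -
  have ge: "int (card (A - {a, x})) \<ge> int m - 2" for x
  proof -
    have "card (A - {a, x}) \<ge> card A - card {a, x}"
      by (rule diff_card_le_card_Diff) simp
    moreover have "card {a, x} \<le> 2" by (simp add: card_insert_if)
    ultimately show ?thesis using assms by linarith
  qed
  have "(int m - 2) * (int m - 1) ^ Suc (length As) + num_path e As b
      \<le> (int m - 2) * (\<Sum>x\<in>B. num_path x As b) + num_path e As b"
    using assms sum_num_path_left[of m As B b] by (simp add: mult_left_mono)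
  also have "\<dots> = (\<Sum>x\<in>B. (int m - 2) * num_path x As b + of_bool (x = e) * num_path x As b)"
    using assms by (simp add: sum.distrib sum_distrib_left of_bool_def if_distrib [of "\<lambda>z. z * _"] cong: if_cong)
  also have "\<dots> \<le> (\<Sum>x\<in>B. int (card (A - {a, x})) * num_path x As b)"
  proof (rule sum_mono)
    fix x
    have "int m - 2 + of_bool (x = e) \<le> int (card (A - {a, x}))"
      using ge[of x] assms by auto
    then have "(int m - 2 + of_bool (x = e)) * num_path x As b \<le> int (card (A - {a, x})) * num_path x As b"
      by (rule mult_right_mono) simp
    then show "(int m - 2) * num_path x As b + of_bool (x = e) * num_path x As b
      \<le> int (card (A - {a, x})) * num_path x As b"
      by (simp add: algebra_simps)
  qed
  also have "\<dots> = num_path a (A # B # As) b"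
    using assms by (simp add: num_path_Cons_Cons)
  finally show ?thesis .
qed

text \<open>Two vertices are removed at a time and the path is continued from a suitable color
  \<open>e\<close>. The parity enters through the base cases: an edge has \<open>offdiag\<close>
  equal to \<open>1\<close> but may admit no coloring, whereas one internal vertex always keeps at
  least \<open>m - 2\<close> colors.\<close>

lemma num_path_ge:
  assumes "m \<ge> 2" "uniform_lists m As"
  shows "num_path a As b \<ge> offdiag m (Suc (length As)) - of_bool (even (length As))"
  using assms(2)
proof (induction As arbitrary: a rule: induct_list012)
  case (2 A)
  have "card (A - {a, b}) \<ge> card A - card {a, b}"
    by (rule diff_card_le_card_Diff) simp
  moreover have "card {a, b} \<le> 2" by (simp add: card_insert_if)
  ultimately show ?case using 2 by (simp add: num_path_single)
next
  case (3 A B As)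
  \<comment> \<open>If \<open>a\<close> is in \<open>A\<close> but not in \<open>B\<close>, then
    \<open>B\<close> has a color outside \<open>A\<close>, as both have \<open>m\<close> elements.
    Otherwise take \<open>e = a\<close>, or any \<open>e\<close> if \<open>a\<close> is not in
    \<open>A\<close>. In each case \<open>{a, e}\<close> meets \<open>A\<close> in at most one
    color.\<close>
  have "\<exists>e\<in>B. card (A - {a, e}) \<ge> m - 1"
  proof (cases "a \<in> A \<and> a \<notin> B")
    case True
    then have "B \<noteq> A" by blast
    then obtain e where "e \<in> B" "e \<notin> A"
      using 3 by (metis card_subset_eq subsetI uniform_lists_simps(2))
    moreover from this have "A - {a, e} = A - {a}" by blast
    then have "card (A - {a, e}) \<ge> m - 1" using True 3 by simp
    ultimately show ?thesis by blast
  next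
    case False
    obtain e where e: "e \<in> B" "a \<in> A \<longrightarrow> e = a"
      using False assms 3 by (metis card_0_eq equals0I not_numeral_le_zero uniform_lists_simps(2))
    then have "A - {a, e} = A - {e}" by auto
    then have "card (A - {a, e}) \<ge> m - 1" using 3 by (simp add: card_Diff_singleton_if)
    with e show ?thesis by blast
  qed
  then obtain e where "e \<in> B" "card (A - {a, e}) \<ge> m - 1" by blast
  then have "num_path a (A # B # As) b \<ge>
    (int m - 2) * (int m - 1) ^ Suc (length As) + num_path e As b"
    using 3 assms by (intro num_path_Cons_Cons_ge) auto
  moreover have "num_path e As b \<ge> offdiag m (Suc (length As)) - of_bool (even (length As))"
    using 3 by simp
  ultimately show ?case by (simp add: offdiag_Suc_Suc del: offdiag.simps)
qed simp

text \<open>If \<open>a\<close> occurs in all lists, then \<open>e = a\<close> is a suitable choice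
  in every two-step. In the base case the only internal vertex lies between two vertices of color
  \<open>a\<close> and has \<open>m - 1\<close> choices, one more than
  \<open>offdiag m 2\<close>.\<close>

lemma num_path_diag_ge:
  assumes "m \<ge> 2" "uniform_lists m As" "odd (length As)" "a \<in> \<Inter> (set As)"
  shows "num_path a As a \<ge> offdiag m (Suc (length As)) + 1"
  using assms(2-)
proof (induction As rule: induct_list012)
  case (3 A B As)
  have "num_path a (A # B # As) a \<ge>
    (int m - 2) * (int m - 1) ^ Suc (length As) + num_path a As a"
    using 3 assms(1) by (intro num_path_Cons_Cons_ge) auto
  moreover have "num_path a As a \<ge> offdiag m (Suc (length As)) + 1"
    using 3 by simp
  ultimately show ?case by (simp add: offdiag_Suc_Suc del: offdiag.simps)
qed (auto simp: num_path_single)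

text \<open>The adjacency matrix of the complete graph on \<open>M\<close> is J - I, with the
  all-ones matrix J and the identity I; its \<open>l\<close>-th power is \<open>offdiag m l\<close>
  times J plus \<open>(- 1) ^ l\<close> times I. Here \<open>l = Suc n\<close>.\<close>

lemma num_path_replicate:
  assumes "finite M" "card M = m" "a \<in> M" "b \<in> M"
  shows "num_path a (replicate n M) b = offdiag m (Suc n) + (- 1) ^ Suc n * of_bool (a = b)"
  using assms(3)
proof (induction n arbitrary: a)
  case (Suc n)
  have "uniform_lists m (replicate n M)" by (simp add: uniform_lists_def assms)
  then have "num_path a (replicate (Suc n) M) b =
      (\<Sum>c\<in>M - {a}. offdiag m (Suc n) + (- 1) ^ Suc n * of_bool (c = b))"
    using assms Suc by (simp add: num_path_Cons[where m = m] del: offdiag.simps)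
  also have "\<dots> = int (card (M - {a})) * offdiag m (Suc n)
      + (- 1) ^ Suc n * (\<Sum>c\<in>M - {a}. of_bool (c = b))"
    by (simp only: sum.distrib sum_distrib_left sum_constant)
  also have "(\<Sum>c\<in>M - {a}. of_bool (c = b)) = (of_bool (a \<noteq> b) :: int)"
    using assms by (auto simp: of_bool_def)
  also have "int (card (M - {a})) = int m - 1"
    using assms Suc.prems card_gt_0_iff[of M] by (auto simp: of_nat_diff Suc_leI)
  also have "(int m - 1) * offdiag m (Suc n) = offdiag m (Suc (Suc n)) - (- 1) ^ Suc n"
    using offdiag_mult[of m "Suc n"] by (simp add: algebra_simps)
  finally show ?case by auto
qed auto

text \<open>A color of \<open>U\<close> outside \<open>A \<inter> S\<close> is missing from
  \<open>A\<close>, or it is in \<open>A\<close> and missing from \<open>S\<close>. The colors of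
  \<open>U\<close> missing from \<open>A\<close> are as many as those of \<open>A\<close> missing
  from \<open>U\<close>, and the latter are the ones that produce the excess.\<close>

lemma card_diff_Int_le:
  assumes "finite U" "finite A" "card U = card A"
  shows "card (U - A \<inter> S) \<le> card (A - U) + card (A - S)"
proof -
  have "card (U - A) = card (A - U)"
    using assms card_Diff_subset_Int[of U A] card_Diff_subset_Int[of A U] by (simp add: Int_commute)
  moreover have "U - A \<inter> S \<subseteq> (U - A) \<union> (A - S)" by blast
  then have "card (U - A \<inter> S) \<le> card (U - A) + card (A - S)"
    using assms by (meson card_Un_le card_mono finite_Diff finite_UnI le_trans)
  ultimately show ?thesis by simp
qed

text \<open>Every color that is missing from the next list of the path frees a choice
  for the next vertex, whence the excess over the constant assignment.\<close>

lemma sum_num_path_ge: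
  assumes "m \<ge> 1" "uniform_lists m As" "finite U" "card U = m" "finite V" "card V = m"
  shows "(\<Sum>a\<in>U. \<Sum>b\<in>V. num_path a As b) \<ge> int m * (int m - 1) ^ Suc (length As)
     + (int m - 1) ^ length As * int (card (U - \<Inter> (set As) \<inter> V))"
  using assms(2-4)
proof (induction As arbitrary: U)
  case Nil
  have "(\<Sum>a\<in>U. \<Sum>b\<in>V. of_bool (a \<noteq> b)) = (\<Sum>a\<in>U. int m - 1 + of_bool (a \<notin> V))"
    using sum_of_bool_neq[OF assms(5)] assms by (intro sum.cong) (auto simp: neq_commute)
  also have "\<dots> = int m * (int m - 1) + int (card (U - V))"
    using Nil by (simp add: sum.distrib of_bool_def sum.If_cases Diff_eq Collect_neg_eq)
  finally show ?case by (simp only: num_path_Nil) simp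
next
  case (Cons A As)
  define R where "R c = (\<Sum>b\<in>V. num_path c As b)" for c
  have R: "R c \<ge> (int m - 1) ^ Suc (length As)" for c
    unfolding R_def using assms Cons.prems by (intro sum_num_path_right) auto
  have "(\<Sum>a\<in>U. \<Sum>b\<in>V. num_path a (A # As) b) = (\<Sum>a\<in>U. \<Sum>c\<in>A. of_bool (c \<noteq> a) * R c)"
  proof (rule sum.cong)
    fix a
    have "(\<Sum>b\<in>V. num_path a (A # As) b) = (\<Sum>b\<in>V. \<Sum>c\<in>A. of_bool (c \<noteq> a) * num_path c As b)"
      using Cons.prems by (simp add: num_path_Cons'[where m = m] del: sum_mult_of_bool_eq sum_of_bool_mult_eq)
    then show "(\<Sum>b\<in>V. num_path a (A # As) b) = (\<Sum>c\<in>A. of_bool (c \<noteq> a) * R c)"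
      by (subst (asm) sum.swap) (simp add: R_def sum_distrib_left)
  qed simp
  also have "\<dots> = (\<Sum>c\<in>A. (\<Sum>a\<in>U. of_bool (a \<noteq> c)) * R c)"
    by (subst sum.swap) (simp add: sum_distrib_right neq_commute)
  \<comment> \<open>A color \<open>c\<close> of the next vertex is compatible with
    \<open>m - 1\<close> colors of \<open>U\<close> if it lies in \<open>U\<close>, and with all
    \<open>m\<close> otherwise.\<close>
  also have "\<dots> = (\<Sum>c\<in>A. (int m - 1) * R c + of_bool (c \<notin> U) * R c)"
    by (intro sum.cong refl, simp only: sum_of_bool_neq[OF Cons.prems(2)] Cons.prems)
      (simp add: algebra_simps)
  also have "\<dots> = (int m - 1) * (\<Sum>c\<in>A. R c) + (\<Sum>c\<in>A. of_bool (c \<notin> U) * R c)"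
    by (simp add: sum.distrib sum_distrib_left)
  also have "(\<Sum>c\<in>A. of_bool (c \<notin> U) * R c) = (\<Sum>c\<in>A - U. R c)"
    using Cons.prems by (intro sum.mono_neutral_cong_right) auto
  finally have eq: "(\<Sum>a\<in>U. \<Sum>b\<in>V. num_path a (A # As) b)
      = (int m - 1) * (\<Sum>c\<in>A. R c) + (\<Sum>c\<in>A - U. R c)" .
  have "(int m - 1) * (\<Sum>c\<in>A. R c) \<ge> (int m - 1) * (int m * (int m - 1) ^ Suc (length As)
     + (int m - 1) ^ length As * int (card (A - \<Inter> (set As) \<inter> V)))"
    unfolding R_def using Cons assms(1) by (intro mult_left_mono) auto
  moreover have "(\<Sum>c\<in>A - U. R c) \<ge> (int m - 1) ^ Suc (length As) * int (card (A - U))"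
    using sum_mono[of "A - U" "\<lambda>_. (int m - 1) ^ Suc (length As)" R] R by (simp add: mult.commute)
  moreover have "(int m - 1) ^ Suc (length As) * int (card (U - \<Inter> (set (A # As)) \<inter> V))
      \<le> (int m - 1) ^ Suc (length As) * (int (card (A - U)) + int (card (A - \<Inter> (set As) \<inter> V)))"
    using card_diff_Int_le[of U A "\<Inter> (set As) \<inter> V"] Cons.prems assms(1)
    by (intro mult_left_mono) (auto simp: Int_assoc)
  ultimately show ?case unfolding eq by (simp add: algebra_simps)
qed

section \<open>Lower bounds for cycles and theta graphs\<close>

definition theta_sum ::
  "nat set \<Rightarrow> nat set \<Rightarrow> nat set list \<Rightarrow> nat set list \<Rightarrow> nat set list \<Rightarrow> int" where
  "theta_sum U V As Bs Cs =
    (\<Sum>a\<in>U. \<Sum>b\<in>V. num_path a As b * num_path a Bs b * num_path a Cs b)"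

lemma theta_sum_perm:
  "theta_sum U V As Bs Cs = theta_sum U V Bs As Cs"
  "theta_sum U V As Bs Cs = theta_sum U V As Cs Bs"
  by (simp_all add: theta_sum_def mult_ac)

text \<open>The chromatic polynomial: there are \<open>m * (m - 1)\<close> pairs of distinct end
  colors and \<open>m\<close> pairs of equal ones, with the path counts of
  \<open>num_path_replicate\<close>.\<close>

definition theta_poly :: "nat \<Rightarrow> nat \<Rightarrow> nat \<Rightarrow> nat \<Rightarrow> int" where
  "theta_poly m i j k =
    int m * (int m - 1) * (offdiag m i * offdiag m j * offdiag m k) +
    int m * ((offdiag m i + (- 1) ^ i) * (offdiag m j + (- 1) ^ j) * (offdiag m k + (- 1) ^ k))"

lemma theta_poly_perm:
  "theta_poly m i j k = theta_poly m j i k"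
  "theta_poly m i j k = theta_poly m i k j"
  by (simp_all add: theta_poly_def mult_ac)

lemma sum_sum_delta:
  fixes f :: "nat \<Rightarrow> int"
  assumes "finite U" "finite V" "K \<subseteq> U \<inter> V"
  shows "(\<Sum>a\<in>U. \<Sum>b\<in>V. of_bool (a = b \<and> a \<in> K) * c) = int (card K) * c"
proof -
  have "(\<Sum>b\<in>V. of_bool (a = b \<and> a \<in> K) * c) = of_bool (a \<in> K) * c" for a
    using assms by (subst sum.mono_neutral_cong_right[of V "{a} \<inter> K" _ "\<lambda>_. c"]) auto
  moreover have "(\<Sum>a\<in>U. of_bool (a \<in> K) * c) = (\<Sum>a\<in>K. c)"
    using assms by (intro sum.mono_neutral_cong_right) auto
  ultimately show ?thesis by simp
qed

lemma sum_num_path_ge_offdiag: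
  assumes "m \<ge> 1" "uniform_lists m As" "finite U" "card U = m" "finite V" "card V = m"
  shows "(\<Sum>a\<in>U. \<Sum>b\<in>V. num_path a As b) \<ge>
     int m * (int m * offdiag m (Suc (length As)) + (- 1) ^ Suc (length As))
     + (int m - 1) ^ length As * int (card (U - \<Inter> (set As) \<inter> V))"
  using sum_num_path_ge[OF assms] offdiag_mult[of m "Suc (length As)"] by simp

lemma card_Int_Int_ge:
  assumes "finite U" "card U = m"
  shows "int (card (U \<inter> S \<inter> T)) \<ge> int m - int (card (U - S)) - int (card (U - T))"
proof -
  have "U = (U \<inter> S \<inter> T) \<union> (U - S) \<union> (U - T)" by blast
  then have "card U \<le> card (U \<inter> S \<inter> T) + card (U - S) + card (U - T)"
    using card_Un_le[of "U \<inter> S \<inter> T \<union> (U - S)" "U - T"] card_Un_le[of "U \<inter> S \<inter> T" "U - S"]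
    by (metis add_le_mono1 le_trans)
  with assms show ?thesis by linarith
qed

text \<open>The right-hand side is the number of \<open>m\<close>-colorings of the even cycle formed
  by both paths. Each path count is at least its off-diagonal value, and exceeds it at equal ends
  whose color survives on both paths. A color that does not survive costs a diagonal term, but adds
  at least one to the total of a path where it is lost.\<close>

lemma even_even_cycle_bound:
  assumes m: "m \<ge> 3" and As: "uniform_lists m As" "odd (length As)"
    and Bs: "uniform_lists m Bs" "odd (length Bs)"
    and U: "finite U" "card U = m" and V: "finite V" "card V = m"
  shows "(\<Sum>a\<in>U. \<Sum>b\<in>V. num_path a As b * num_path a Bs b)
    \<ge> (int m - 1) ^ (length As + length Bs + 2) + int m - 1"
proof -
  define p where "p = offdiag m (Suc (length As))"
  define q where "q = offdiag m (Suc (length Bs))"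
  define g where "g = int (card (U - \<Inter> (set As) \<inter> V))"
  define h where "h = int (card (U - \<Inter> (set Bs) \<inter> V))"
  define K where "K = U \<inter> (\<Inter> (set As) \<inter> V) \<inter> (\<Inter> (set Bs) \<inter> V)"
  have p1: "p \<ge> 1" and q1: "q \<ge> 1" unfolding p_def q_def using m by (auto intro!: offdiag_pos simp del: offdiag.simps)
  have g0: "g \<ge> 0" "h \<ge> 0" by (auto simp: g_def h_def)
  have pw: "1 \<le> (int m - 1) ^ n" for n using m by simp
  have TA: "(\<Sum>a\<in>U. \<Sum>b\<in>V. num_path a As b) \<ge> int m * (int m * p + 1) + g"
    using sum_num_path_ge_offdiag[OF _ As(1) U V] m As(2) mult_right_mono[OF pw g0(1), of "length As"]
    by (simp add: p_def g_def del: offdiag.simps)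
  have TB: "(\<Sum>a\<in>U. \<Sum>b\<in>V. num_path a Bs b) \<ge> int m * (int m * q + 1) + h"
    using sum_num_path_ge_offdiag[OF _ Bs(1) U V] m Bs(2) mult_right_mono[OF pw g0(2), of "length Bs"]
    by (simp add: q_def h_def del: offdiag.simps)
  have K: "int (card K) \<ge> int m - g - h"
    unfolding K_def g_def h_def using card_Int_Int_ge[OF U] .
  \<comment> \<open>The product is expanded around \<open>p * q\<close>: the linear terms are summed
    by \<open>TA\<close> and \<open>TB\<close>, and the mixed term is at least the indicator of a
    surviving diagonal color.\<close>
  have pt: "num_path a As b * num_path a Bs b \<ge> - (p * q) + q * num_path a As b + p * num_path a Bs b
      + of_bool (a = b \<and> a \<in> K) * 1" for a b
  proof -
    define x where "x = num_path a As b - p"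
    define y where "y = num_path a Bs b - q"
    define d where "d = (of_bool (a = b \<and> a \<in> K) :: int)"
    have x: "x \<ge> d"
      using num_path_ge[of m As a b] num_path_diag_ge[of m As a] m As
      by (auto simp: x_def d_def p_def K_def simp del: offdiag.simps)
    have y: "y \<ge> d"
      using num_path_ge[of m Bs a b] num_path_diag_ge[of m Bs a] m Bs
      by (auto simp: y_def d_def q_def K_def simp del: offdiag.simps)
    have d: "d \<ge> 0" "d * d = d" by (auto simp: d_def)
    have "x * y \<ge> d" using mult_mono[of d x d y] x y d by simp
    then have "(p + x) * (q + y) \<ge> - (p * q) + q * (p + x) + p * (q + y) + d * 1"
      by (simp add: algebra_simps)
    then show ?thesis by (simp add: x_def y_def d_def)
  qed
  have "(\<Sum>a\<in>U. \<Sum>b\<in>V. num_path a As b * num_path a Bs b) \<ge>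
     (\<Sum>a\<in>U. \<Sum>b\<in>V. - (p * q) + q * num_path a As b + p * num_path a Bs b
      + of_bool (a = b \<and> a \<in> K) * 1)"
    by (intro sum_mono pt)
  also have "(\<Sum>a\<in>U. \<Sum>b\<in>V. - (p * q) + q * num_path a As b + p * num_path a Bs b
      + of_bool (a = b \<and> a \<in> K) * 1) =
     - (int m * int m * (p * q)) + q * (\<Sum>a\<in>U. \<Sum>b\<in>V. num_path a As b)
      + p * (\<Sum>a\<in>U. \<Sum>b\<in>V. num_path a Bs b) + (\<Sum>a\<in>U. \<Sum>b\<in>V. of_bool (a = b \<and> a \<in> K) * 1)"
    by (simp only: sum.distrib sum_distrib_left sum_constant U V)
  also have "(\<Sum>a\<in>U. \<Sum>b\<in>V. of_bool (a = b \<and> a \<in> K) * 1) = int (card K) * 1"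
    by (rule sum_sum_delta) (use U V in \<open>auto simp: K_def\<close>)
  finally have 1: "(\<Sum>a\<in>U. \<Sum>b\<in>V. num_path a As b * num_path a Bs b) \<ge>
     - (int m * int m * (p * q)) + q * (\<Sum>a\<in>U. \<Sum>b\<in>V. num_path a As b)
      + p * (\<Sum>a\<in>U. \<Sum>b\<in>V. num_path a Bs b) + int (card K) * 1" .
  \<comment> \<open>Since \<open>p\<close> and \<open>q\<close> are at least \<open>1\<close>, the
    excesses \<open>g\<close> and \<open>h\<close> enter in full and cancel the loss in
    \<open>card K\<close>.\<close>
  have 2: "q * (\<Sum>a\<in>U. \<Sum>b\<in>V. num_path a As b) \<ge> q * (int m * (int m * p + 1)) + g"
    using mult_left_mono[OF TA, of q] mult_right_mono[OF q1 g0(1)] q1 by (simp add: algebra_simps)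
  have 3: "p * (\<Sum>a\<in>U. \<Sum>b\<in>V. num_path a Bs b) \<ge> p * (int m * (int m * q + 1)) + h"
    using mult_left_mono[OF TB, of p] mult_right_mono[OF p1 g0(2)] p1 by (simp add: algebra_simps)
  have "(int m - 1) ^ (length As + length Bs + 2) = (int m * p + 1) * (int m * q + 1)"
    using offdiag_mult[of m "Suc (length As)"] offdiag_mult[of m "Suc (length Bs)"] As(2) Bs(2)
    by (simp add: p_def q_def power_add power2_eq_square mult_ac del: offdiag.simps)
  then show ?thesis using 1 2 3 K by (simp add: algebra_simps)
qed

text \<open>Moving one end of the two paths to a neighbor along the cycle makes both lengths even.\<close>

lemma odd_odd_cycle_bound:
  assumes m: "m \<ge> 3" and As: "uniform_lists m As" "even (length As)"
    and Bs: "uniform_lists m Bs" "even (length Bs)" and "length As + length Bs > 0"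
    and U: "finite U" "card U = m" and V: "finite V" "card V = m"
  shows "(\<Sum>a\<in>U. \<Sum>b\<in>V. num_path a As b * num_path a Bs b)
    \<ge> (int m - 1) ^ (length As + length Bs + 2) + int m - 1"
proof -
  \<comment> \<open>By symmetry, a path with an internal vertex may come first.\<close>
  have main: "(\<Sum>a\<in>U. \<Sum>b\<in>V. num_path a As b * num_path a Bs b)
    \<ge> (int m - 1) ^ (length As + length Bs + 2) + int m - 1"
    if As: "uniform_lists m As" "even (length As)" and Bs: "uniform_lists m Bs" "even (length Bs)"
      and "As \<noteq> []" for As Bs
  proof -
    obtain A As' where A: "As = A # As'" using \<open>As \<noteq> []\<close> by (cases As) auto
    have fin: "finite A" "card A = m" "uniform_lists m As'" using As A by auto
    have "(\<Sum>a\<in>U. \<Sum>b\<in>V. num_path a As b * num_path a Bs b) =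
        (\<Sum>a\<in>U. \<Sum>b\<in>V. \<Sum>c\<in>A. of_bool (c \<noteq> a) * num_path c As' b * num_path a Bs b)"
      by (simp only: A num_path_Cons'[OF fin(1,3)] sum_distrib_right)
    also have "\<dots> = (\<Sum>c\<in>A. \<Sum>b\<in>V. \<Sum>a\<in>U. of_bool (c \<noteq> a) * num_path c As' b * num_path a Bs b)"
    proof -
      have "(\<Sum>a\<in>U. \<Sum>b\<in>V. \<Sum>c\<in>A. f a b c) = (\<Sum>c\<in>A. \<Sum>b\<in>V. \<Sum>a\<in>U. f a b c)"
        for f :: "nat \<Rightarrow> nat \<Rightarrow> nat \<Rightarrow> int"
      proof -
        have "(\<Sum>a\<in>U. \<Sum>b\<in>V. \<Sum>c\<in>A. f a b c) = (\<Sum>a\<in>U. \<Sum>c\<in>A. \<Sum>b\<in>V. f a b c)"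
          by (intro sum.cong refl sum.swap)
        also have "\<dots> = (\<Sum>c\<in>A. \<Sum>a\<in>U. \<Sum>b\<in>V. f a b c)"
          by (rule sum.swap)
        also have "\<dots> = (\<Sum>c\<in>A. \<Sum>b\<in>V. \<Sum>a\<in>U. f a b c)"
          by (intro sum.cong refl sum.swap)
        finally show ?thesis .
      qed
      then show ?thesis .
    qed
    \<comment> \<open>The neighbor with list \<open>A\<close> becomes the new end, and
      \<open>U\<close> is now the list of an internal vertex of the second path.\<close>
    also have "\<dots> = (\<Sum>c\<in>A. \<Sum>b\<in>V. num_path c As' b * num_path c (U # Bs) b)"
      by (simp only: num_path_Cons'[OF U(1) Bs(1)] sum_distrib_left mult.commute mult.left_commute
          neq_commute)
    also have "\<dots> \<ge> (int m - 1) ^ (length As' + length (U # Bs) + 2) + int m - 1"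
      using As Bs U V m fin A by (intro even_even_cycle_bound) auto
    finally show ?thesis by (simp add: A)
  qed
  show ?thesis
  proof (cases "As = []")
    case True
    then show ?thesis using main[of Bs As] assms by (simp add: mult.commute add.commute)
  next
    case False
    then show ?thesis using main[of As Bs] assms by simp
  qed
qed

text \<open>The product is expanded around \<open>p\<close>, \<open>q\<close> and
  \<open>r - 1\<close>, the last because an odd path can fall one below its off-diagonal value. The
  remainder is nonnegative, and at least \<open>r - 1\<close> at equal ends whose color survives on
  both even paths. All these bounds are attained by the constant assignment, which is why they sum
  to \<open>theta_poly\<close>.\<close>

lemma theta_even_even_odd_bound:
  assumes m: "m \<ge> 3" and As: "uniform_lists m As" "odd (length As)"
    and Bs: "uniform_lists m Bs" "odd (length Bs)"
    and Cs: "uniform_lists m Cs" "even (length Cs)"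
    and U: "finite U" "card U = m" and V: "finite V" "card V = m"
  shows "theta_sum U V As Bs Cs \<ge> theta_poly m (Suc (length As)) (Suc (length Bs)) (Suc (length Cs))"
proof -
  define p where "p = offdiag m (Suc (length As))"
  define q where "q = offdiag m (Suc (length Bs))"
  define r where "r = offdiag m (Suc (length Cs))"
  define g where "g = int (card (U - \<Inter> (set As) \<inter> V))"
  define h where "h = int (card (U - \<Inter> (set Bs) \<inter> V))"
  define K where "K = U \<inter> (\<Inter> (set As) \<inter> V) \<inter> (\<Inter> (set Bs) \<inter> V)"
  define SA where "SA = (\<Sum>a\<in>U. \<Sum>b\<in>V. num_path a As b)"
  define SB where "SB = (\<Sum>a\<in>U. \<Sum>b\<in>V. num_path a Bs b)"
  define SC where "SC = (\<Sum>a\<in>U. \<Sum>b\<in>V. num_path a Cs b)"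
  have p1: "p \<ge> 1" and q1: "q \<ge> 1" and r1: "r \<ge> 1"
    unfolding p_def q_def r_def using m by (auto intro!: offdiag_pos simp del: offdiag.simps)
  have g0: "g \<ge> 0" "h \<ge> 0" by (auto simp: g_def h_def)
  have pw: "1 \<le> (int m - 1) ^ n" for n using m by simp
  have TA: "SA \<ge> int m * (int m * p + 1) + g"
    using sum_num_path_ge_offdiag[OF _ As(1) U V] m As(2) mult_right_mono[OF pw g0(1), of "length As"]
    by (simp add: SA_def p_def g_def del: offdiag.simps)
  have TB: "SB \<ge> int m * (int m * q + 1) + h"
    using sum_num_path_ge_offdiag[OF _ Bs(1) U V] m Bs(2) mult_right_mono[OF pw g0(2), of "length Bs"]
    by (simp add: SB_def q_def h_def del: offdiag.simps)
  have TC: "SC \<ge> int m * (int m * r - 1)"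
  proof -
    have "0 \<le> (int m - 1) ^ length Cs * int (card (U - \<Inter> (set Cs) \<inter> V))"
      using m by simp
    moreover have "SC \<ge> int m * (int m * r - 1)
        + (int m - 1) ^ length Cs * int (card (U - \<Inter> (set Cs) \<inter> V))"
      using sum_num_path_ge_offdiag[OF _ Cs(1) U V] m Cs(2)
      by (simp add: SC_def r_def del: offdiag.simps)
    ultimately show ?thesis by linarith
  qed
  have K: "int (card K) \<ge> int m - g - h"
    unfolding K_def g_def h_def using card_Int_Int_ge[OF U] .
  have pt: "num_path a As b * num_path a Bs b * num_path a Cs b \<ge>
      - (2 * p * q * (r - 1)) + q * (r - 1) * num_path a As b + p * (r - 1) * num_path a Bs b
      + p * q * num_path a Cs b + of_bool (a = b \<and> a \<in> K) * (r - 1)" for a b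
  proof -
    define x where "x = num_path a As b - p"
    define y where "y = num_path a Bs b - q"
    define z where "z = num_path a Cs b - r"
    define d where "d = (of_bool (a = b \<and> a \<in> K) :: int)"
    have x: "x \<ge> d"
      using num_path_ge[of m As a b] num_path_diag_ge[of m As a] m As
      by (auto simp: x_def d_def p_def K_def simp del: offdiag.simps)
    have y: "y \<ge> d"
      using num_path_ge[of m Bs a b] num_path_diag_ge[of m Bs a] m Bs
      by (auto simp: y_def d_def q_def K_def simp del: offdiag.simps)
    have z: "z \<ge> - 1"
      using num_path_ge[of m Cs a b] m Cs by (auto simp: z_def r_def simp del: offdiag.simps)
    have d: "d \<ge> 0" "d * d = d" by (auto simp: d_def)
    have xy: "x * y \<ge> d" using mult_mono[of d x d y] x y d by simp
    have "x * y * (r + z) \<ge> d * (r - 1)"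
      using xy z d r1 by (intro mult_mono) auto
    moreover have "p * y * (z + 1) \<ge> 0" "q * x * (z + 1) \<ge> 0"
      using p1 q1 x y z d by auto
    ultimately have "(p + x) * (q + y) * (r + z) \<ge> - (2 * p * q * (r - 1)) + q * (r - 1) * (p + x)
        + p * (r - 1) * (q + y) + p * q * (r + z) + d * (r - 1)"
      by (simp add: algebra_simps)
    then show ?thesis by (simp add: x_def y_def z_def d_def)
  qed
  have "theta_sum U V As Bs Cs \<ge> (\<Sum>a\<in>U. \<Sum>b\<in>V. - (2 * p * q * (r - 1)) + q * (r - 1) * num_path a As b
      + p * (r - 1) * num_path a Bs b + p * q * num_path a Cs b + of_bool (a = b \<and> a \<in> K) * (r - 1))"
    unfolding theta_sum_def by (intro sum_mono pt)
  also have "(\<Sum>a\<in>U. \<Sum>b\<in>V. - (2 * p * q * (r - 1)) + q * (r - 1) * num_path a As b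
      + p * (r - 1) * num_path a Bs b + p * q * num_path a Cs b + of_bool (a = b \<and> a \<in> K) * (r - 1)) =
     - (int m * int m * (2 * p * q * (r - 1))) + q * (r - 1) * SA + p * (r - 1) * SB + p * q * SC
     + (\<Sum>a\<in>U. \<Sum>b\<in>V. of_bool (a = b \<and> a \<in> K) * (r - 1))"
    unfolding SA_def SB_def SC_def
    by (simp only: sum.distrib sum_distrib_left sum_constant U V)
  also have "(\<Sum>a\<in>U. \<Sum>b\<in>V. of_bool (a = b \<and> a \<in> K) * (r - 1)) = int (card K) * (r - 1)"
    by (rule sum_sum_delta) (use U V in \<open>auto simp: K_def\<close>)
  finally have 1: "theta_sum U V As Bs Cs \<ge> - (int m * int m * (2 * p * q * (r - 1)))
      + q * (r - 1) * SA + p * (r - 1) * SB + p * q * SC + int (card K) * (r - 1)" .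
  \<comment> \<open>As \<open>q\<close> is at least \<open>1\<close>, the excess \<open>g\<close> is
    counted with a factor of at least \<open>r - 1\<close>, which is what a color missing from
    \<open>K\<close> costs in the diagonal sum.\<close>
  have 2: "q * (r - 1) * SA \<ge> q * (r - 1) * (int m * (int m * p + 1)) + (r - 1) * g"
  proof -
    have "q * (r - 1) * SA \<ge> q * (r - 1) * (int m * (int m * p + 1) + g)"
      using TA q1 r1 by (intro mult_left_mono) auto
    moreover have "q * ((r - 1) * g) \<ge> 1 * ((r - 1) * g)"
      using q1 r1 g0 by (intro mult_right_mono) auto
    ultimately show ?thesis by (simp add: algebra_simps)
  qed
  have 3: "p * (r - 1) * SB \<ge> p * (r - 1) * (int m * (int m * q + 1)) + (r - 1) * h"
  proof -
    have "p * (r - 1) * SB \<ge> p * (r - 1) * (int m * (int m * q + 1) + h)"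
      using TB p1 r1 by (intro mult_left_mono) auto
    moreover have "p * ((r - 1) * h) \<ge> 1 * ((r - 1) * h)"
      using p1 r1 g0 by (intro mult_right_mono) auto
    ultimately show ?thesis by (simp add: algebra_simps)
  qed
  have 4: "p * q * SC \<ge> p * q * (int m * (int m * r - 1))"
    using TC p1 q1 by (intro mult_left_mono) auto
  have 5: "int (card K) * (r - 1) \<ge> (int m - g - h) * (r - 1)"
    using K r1 by (intro mult_right_mono) auto
  have "theta_poly m (Suc (length As)) (Suc (length Bs)) (Suc (length Cs)) =
      int m * (int m - 1) * (p * q * r) + int m * ((p + 1) * (q + 1) * (r - 1))"
    using As(2) Bs(2) Cs(2) by (simp add: theta_poly_def p_def q_def r_def del: offdiag.simps)
  then show ?thesis using 1 2 3 4 5 by (simp add: algebra_simps)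
qed

text \<open>The two odd paths are bounded jointly, as an even cycle. The even path count is at least
  \<open>p\<close> and the product of the odd ones at least \<open>(q - 1) * (r - 1)\<close>; the
  product of these two excesses is nonnegative, so only terms with known totals remain.\<close>

lemma theta_even_odd_odd_bound:
  assumes m: "m \<ge> 3" and As: "uniform_lists m As" "odd (length As)"
    and Bs: "uniform_lists m Bs" "even (length Bs)"
    and Cs: "uniform_lists m Cs" "even (length Cs)" and "length Bs + length Cs > 0"
    and U: "finite U" "card U = m" and V: "finite V" "card V = m"
  shows "theta_sum U V As Bs Cs \<ge> theta_poly m (Suc (length As)) (Suc (length Bs)) (Suc (length Cs))"
proof -
  define p where "p = offdiag m (Suc (length As))"
  define q where "q = offdiag m (Suc (length Bs))"
  define r where "r = offdiag m (Suc (length Cs))"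
  define SA where "SA = (\<Sum>a\<in>U. \<Sum>b\<in>V. num_path a As b)"
  define SBC where "SBC = (\<Sum>a\<in>U. \<Sum>b\<in>V. num_path a Bs b * num_path a Cs b)"
  have p1: "p \<ge> 1" and q1: "q \<ge> 1" and r1: "r \<ge> 1"
    unfolding p_def q_def r_def using m by (auto intro!: offdiag_pos simp del: offdiag.simps)
  have TA: "SA \<ge> int m * (int m * p + 1)"
  proof -
    have "0 \<le> (int m - 1) ^ length As * int (card (U - \<Inter> (set As) \<inter> V))"
      using m by simp
    moreover have "SA \<ge> int m * (int m * p + 1)
        + (int m - 1) ^ length As * int (card (U - \<Inter> (set As) \<inter> V))"
      using sum_num_path_ge_offdiag[OF _ As(1) U V] m As(2)
      by (simp add: SA_def p_def del: offdiag.simps)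
    ultimately show ?thesis by linarith
  qed
  have TBC: "SBC \<ge> (int m * q - 1) * (int m * r - 1) + int m - 1"
  proof -
    have "(int m - 1) ^ (length Bs + length Cs + 2) = (int m * q - 1) * (int m * r - 1)"
      using offdiag_mult[of m "Suc (length Bs)"] offdiag_mult[of m "Suc (length Cs)"] Bs(2) Cs(2)
      by (simp add: q_def r_def power_add power2_eq_square mult_ac del: offdiag.simps)
    then show ?thesis using odd_odd_cycle_bound[OF m Bs Cs _ U V] assms by (simp add: SBC_def)
  qed
  have pt: "num_path a As b * num_path a Bs b * num_path a Cs b \<ge>
     - (p * (q - 1) * (r - 1)) + p * (num_path a Bs b * num_path a Cs b)
     + (q - 1) * (r - 1) * num_path a As b" for a b
  proof -
    have x: "num_path a As b \<ge> p"
      using num_path_ge[of m As a b] m As by (auto simp: p_def simp del: offdiag.simps)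
    have y: "num_path a Bs b \<ge> q - 1"
      using num_path_ge[of m Bs a b] m Bs by (auto simp: q_def simp del: offdiag.simps)
    have z: "num_path a Cs b \<ge> r - 1"
      using num_path_ge[of m Cs a b] m Cs by (auto simp: r_def simp del: offdiag.simps)
    have "(num_path a As b - p) * ((q - 1) * (r - 1)) \<le>
        (num_path a As b - p) * (num_path a Bs b * num_path a Cs b)"
      using x y z q1 r1 by (intro mult_left_mono mult_mono) auto
    then show ?thesis by (simp add: algebra_simps)
  qed
  have "theta_sum U V As Bs Cs \<ge> (\<Sum>a\<in>U. \<Sum>b\<in>V. - (p * (q - 1) * (r - 1))
      + p * (num_path a Bs b * num_path a Cs b) + (q - 1) * (r - 1) * num_path a As b)"
    unfolding theta_sum_def by (intro sum_mono pt)
  also have "(\<Sum>a\<in>U. \<Sum>b\<in>V. - (p * (q - 1) * (r - 1))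
      + p * (num_path a Bs b * num_path a Cs b) + (q - 1) * (r - 1) * num_path a As b) =
     - (int m * int m * (p * (q - 1) * (r - 1))) + p * SBC + (q - 1) * (r - 1) * SA"
    unfolding SA_def SBC_def
    by (simp only: sum.distrib sum_distrib_left sum_constant U V)
  finally have 1: "theta_sum U V As Bs Cs \<ge>
     - (int m * int m * (p * (q - 1) * (r - 1))) + p * SBC + (q - 1) * (r - 1) * SA" .
  have 2: "p * SBC \<ge> p * ((int m * q - 1) * (int m * r - 1) + int m - 1)"
    using TBC p1 by (intro mult_left_mono) auto
  have 3: "(q - 1) * (r - 1) * SA \<ge> (q - 1) * (r - 1) * (int m * (int m * p + 1))"
    using TA q1 r1 by (intro mult_left_mono) auto
  have "theta_poly m (Suc (length As)) (Suc (length Bs)) (Suc (length Cs)) =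
      int m * (int m - 1) * (p * q * r) + int m * ((p + 1) * (q - 1) * (r - 1))"
    using As(2) Bs(2) Cs(2) by (simp add: theta_poly_def p_def q_def r_def del: offdiag.simps)
  then show ?thesis using 1 2 3 by (simp add: algebra_simps)
qed

text \<open>For paths of length two, the number of colorings with equal ends is at least m - 1
  even if that color is missing from the middle list.  So only the colors
  in U - V are lost, and these already give the required excess.\<close>

lemma theta_2_2_2_bound:
  assumes m: "m \<ge> 3" and As: "uniform_lists m [A, B, C]"
    and U: "finite U" "card U = m" and V: "finite V" "card V = m"
  shows "theta_sum U V [A] [B] [C] \<ge> theta_poly m 2 2 2"
proof -
  define p where "p = int m - 2"
  define h where "h = int (card (U - V))"
  define S where "S A = (\<Sum>a\<in>U. \<Sum>b\<in>V. num_path a [A] b)" for A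
  have p1: "p \<ge> 1" unfolding p_def using m by auto
  have h0: "h \<ge> 0" by (auto simp: h_def)
  have T: "S A \<ge> int m * (int m * p + 1) + (p + 1) * h" if "finite A" "card A = m" for A
  proof -
    have "h \<le> int (card (U - A \<inter> V))"
      unfolding h_def using U by (auto intro!: card_mono)
    then have "(int m - 1) * h \<le> (int m - 1) * int (card (U - A \<inter> V))"
      using m by (intro mult_left_mono) auto
    moreover have "S A \<ge> int m * (int m * p + 1) + (int m - 1) * int (card (U - A \<inter> V))"
      using sum_num_path_ge_offdiag[of m "[A]", OF _ _ U V] m that
      by (simp add: S_def p_def)
    ultimately show ?thesis by (simp add: p_def)
  qed
  have ge: "num_path a [A] b \<ge> p + of_bool (a = b \<and> a \<in> U \<inter> V)" if "finite A" "card A = m" for a b A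
  proof -
    have "card (A - {a, b}) \<ge> card A - card {a, b}"
      by (rule diff_card_le_card_Diff) simp
    moreover have "card {a, b} + of_bool (a = b \<and> a \<in> U \<inter> V) \<le> 2" by (simp add: card_insert_if)
    ultimately show ?thesis using that m by (auto simp: num_path_single p_def)
  qed
  \<comment> \<open>\<open>3 * p + 1\<close> collects the terms of second and third order in
    \<open>(p + x) * (p + y) * (p + z)\<close> for \<open>x = y = z = 1\<close>.\<close>
  have pt: "num_path a [A] b * num_path a [B] b * num_path a [C] b \<ge>
      - (2 * p * p * p) + p * p * num_path a [A] b + p * p * num_path a [B] b
      + p * p * num_path a [C] b + of_bool (a = b \<and> a \<in> U \<inter> V) * (3 * p + 1)" for a b
  proof -
    define x where "x = num_path a [A] b - p"
    define y where "y = num_path a [B] b - p"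
    define z where "z = num_path a [C] b - p"
    define d where "d = (of_bool (a = b \<and> a \<in> U \<inter> V) :: int)"
    have xyz: "x \<ge> d" "y \<ge> d" "z \<ge> d"
      using ge[of A a b] ge[of B a b] ge[of C a b] As by (auto simp: x_def y_def z_def d_def)
    have d: "d \<ge> 0" "d * d = d" by (auto simp: d_def)
    have xy: "x * y \<ge> d" "x * z \<ge> d" "y * z \<ge> d"
      using mult_mono[of d x d y] mult_mono[of d x d z] mult_mono[of d y d z] xyz d by auto
    have "p * (x * y) \<ge> p * d" "p * (x * z) \<ge> p * d" "p * (y * z) \<ge> p * d"
      using xy p1 by (auto intro: mult_left_mono)
    moreover have "x * y * z \<ge> d"
      using mult_mono[of d "x * y" d z] xy xyz d by simp
    ultimately have "(p + x) * (p + y) * (p + z) \<ge> - (2 * p * p * p) + p * p * (p + x)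
        + p * p * (p + y) + p * p * (p + z) + d * (3 * p + 1)"
      by (simp add: algebra_simps)
    then show ?thesis by (simp add: x_def y_def z_def d_def)
  qed
  have "theta_sum U V [A] [B] [C] \<ge> (\<Sum>a\<in>U. \<Sum>b\<in>V. - (2 * p * p * p) + p * p * num_path a [A] b
      + p * p * num_path a [B] b + p * p * num_path a [C] b + of_bool (a = b \<and> a \<in> U \<inter> V) * (3 * p + 1))"
    unfolding theta_sum_def by (intro sum_mono pt)
  also have "(\<Sum>a\<in>U. \<Sum>b\<in>V. - (2 * p * p * p) + p * p * num_path a [A] b
      + p * p * num_path a [B] b + p * p * num_path a [C] b + of_bool (a = b \<and> a \<in> U \<inter> V) * (3 * p + 1)) =
     - (int m * int m * (2 * p * p * p)) + p * p * S A + p * p * S B + p * p * S C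
     + (\<Sum>a\<in>U. \<Sum>b\<in>V. of_bool (a = b \<and> a \<in> U \<inter> V) * (3 * p + 1))"
    unfolding S_def
    by (simp only: sum.distrib sum_distrib_left sum_constant U V)
  also have "(\<Sum>a\<in>U. \<Sum>b\<in>V. of_bool (a = b \<and> a \<in> U \<inter> V) * (3 * p + 1))
      = int (card (U \<inter> V)) * (3 * p + 1)"
    by (rule sum_sum_delta) (use U V in auto)
  also have "int (card (U \<inter> V)) = int m - h"
    using U card_Int_Diff[of U V] by (simp add: h_def)
  finally have 1: "theta_sum U V [A] [B] [C] \<ge> - (int m * int m * (2 * p * p * p))
      + p * p * S A + p * p * S B + p * p * S C + (int m - h) * (3 * p + 1)" .
  have 2: "p * p * S X \<ge> p * p * (int m * (int m * p + 1) + (p + 1) * h)" if "X \<in> {A, B, C}" for X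
    using T[of X] that As p1 by (intro mult_left_mono) auto
  \<comment> \<open>For each color of \<open>U - V\<close>, the three path totals gain
    \<open>3 * p * p * (p + 1)\<close> and the diagonal loses \<open>3 * p + 1\<close>.\<close>
  have "(3 * p * p * (p + 1) - (3 * p + 1)) * h \<ge> 0"
  proof -
    have "p * p \<ge> 1" "p * p * p \<ge> 1" using p1 by (auto simp: one_le_mult_int)
    moreover have "p * p \<ge> p" using p1 by simp
    ultimately show ?thesis using h0 by (intro mult_nonneg_nonneg) (auto simp: algebra_simps)
  qed
  moreover have "theta_poly m 2 2 2 = int m * (int m - 1) * (p * p * p) + int m * ((p + 1) * (p + 1) * (p + 1))"
    by (simp add: theta_poly_def p_def numeral_2_eq_2)
  ultimately show ?thesis using 1 2[of A] 2[of B] 2[of C] by (simp add: algebra_simps)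
qed

section \<open>Lengths 2, 2, 2 with two colors\<close>

text \<open>The factors stand for the counts of the three paths at two disjoint pairs of end colors.
  A factor vanishes only if the middle list is that pair, and then the factor for the other pair is
  \<open>2\<close>. So a vanishing product is made up for by a factor \<open>2\<close> in the other
  one.\<close>

lemma opposite_products:
  fixes x y z x' y' z' :: int
  assumes "x \<ge> 0" "y \<ge> 0" "z \<ge> 0" "x' \<ge> 0" "y' \<ge> 0" "z' \<ge> 0"
    and "x \<noteq> 0 \<or> x' = 2" "y \<noteq> 0 \<or> y' = 2" "z \<noteq> 0 \<or> z' = 2"
    and "x' \<noteq> 0 \<or> x = 2" "y' \<noteq> 0 \<or> y = 2" "z' \<noteq> 0 \<or> z = 2"
    and "x * y * z \<noteq> 0 \<or> x' * y' * z' \<noteq> 0"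
  shows "x * y * z + x' * y' * z' \<ge> 2"
proof -
  have ge: "a \<ge> 1 \<and> b \<ge> 1 \<and> c \<ge> 1" if "a \<ge> 0" "b \<ge> 0" "c \<ge> 0" "a * b * c \<noteq> 0" for a b c :: int
  proof -
    have "a \<noteq> 0" "b \<noteq> 0" "c \<noteq> 0" using that(4) by auto
    then show ?thesis using that by linarith
  qed
  have pos: "a * b * c \<ge> 1" if "a \<ge> 0" "b \<ge> 0" "c \<ge> 0" "a * b * c \<noteq> 0" for a b c :: int
    using ge[OF that] by (intro one_le_mult_int) auto
  have two: "a * b * c \<ge> 2" if "a \<ge> 0" "b \<ge> 0" "c \<ge> 0" "a * b * c \<noteq> 0" "a = 2 \<or> b = 2 \<or> c = 2"
    for a b c :: int
    using that(5) ge[OF that(1-4)] one_le_mult_int[of a b] one_le_mult_int[of a c] one_le_mult_int[of b c]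
    by (elim disjE) (simp_all add: mult.assoc)
  consider "x * y * z \<noteq> 0" "x' * y' * z' \<noteq> 0" | "x * y * z = 0" "x' * y' * z' \<noteq> 0"
    | "x * y * z \<noteq> 0" "x' * y' * z' = 0"
    using assms(13) by blast
  then show ?thesis
  proof cases
    case 1
    then show ?thesis using pos[OF assms(1-3)] pos[OF assms(4-6)] by linarith
  next
    case 2
    then have "x' = 2 \<or> y' = 2 \<or> z' = 2" using assms(7-9) by (metis mult_eq_0_iff)
    then have "x' * y' * z' \<ge> 2" using two[OF assms(4-6)] 2(2) by blast
    with 2(1) show ?thesis by linarith
  next
    case 3
    then have "x = 2 \<or> y = 2 \<or> z = 2" using assms(10-12) by (metis mult_eq_0_iff)
    then have "x * y * z \<ge> 2" using two[OF assms(1-3)] 3(1) by blast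
    with 3(2) show ?thesis by linarith
  qed
qed

lemma num_path_single_eq_0:
  assumes "finite A" "card A = 2"
  shows "num_path a [A] b = 0 \<longleftrightarrow> A = {a, b} \<and> a \<noteq> b"
proof
  assume "num_path a [A] b = 0"
  then have "A \<subseteq> {a, b}" using assms by (simp add: num_path_single)
  then show "A = {a, b} \<and> a \<noteq> b"
    using assms card_mono[of "{a, b}" A] by (auto simp: card_2_iff doubleton_eq_iff)
qed (auto simp: num_path_single)

text \<open>The graph is complete bipartite with parts of sizes 2 and 3 and has two colorings from
  two colors. The cases are two, one or no common colors of the end lists.\<close>

lemma theta_2_2_2_bound_two:
  assumes As: "uniform_lists 2 [A, B, C]"
    and U: "finite U" "card U = 2" and V: "finite V" "card V = 2"
  shows "theta_sum U V [A] [B] [C] \<ge> 2"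
proof -
  define P where "P a b = num_path a [A] b * num_path a [B] b * num_path a [C] b" for a b
  have P0: "P a b \<ge> 0" for a b by (simp add: P_def)
  have pos: "num_path a [X] b \<ge> 1 \<longleftrightarrow> \<not> (X = {a, b} \<and> a \<noteq> b)" if "X \<in> {A, B, C}" for X a b
    using num_path_single_eq_0[of X a b] num_path_nonneg[of a "[X]" b] As that
    by (auto simp del: num_path_nonneg)
  have P1: "P a b \<ge> 1" if "\<And>X. X \<in> {A, B, C} \<Longrightarrow> \<not> (X = {a, b} \<and> a \<noteq> b)" for a b
  proof -
    have "num_path a [A] b \<ge> 1" "num_path a [B] b \<ge> 1" "num_path a [C] b \<ge> 1"
      using pos that by auto
    then show ?thesis unfolding P_def by (simp add: one_le_mult_int)
  qed
  have opp: "num_path c [X] d = 2" if "num_path a [X] b = 0" "X \<in> {A, B, C}" "{a, b} \<inter> {c, d} = {}"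
    for a b c d X
  proof -
    have "X = {a, b}" "finite X" "card X = 2" "X - {c, d} = X"
      using num_path_single_eq_0[of X a b] As that by auto
    then show ?thesis by (simp add: num_path_single)
  qed
  have sum: "theta_sum {u1, u2} {v1, v2} [A] [B] [C] = P u1 v1 + P u1 v2 + P u2 v1 + P u2 v2"
    if "u1 \<noteq> u2" "v1 \<noteq> v2" for u1 u2 v1 v2
    using that by (simp add: theta_sum_def P_def)
  consider "U = V" | u1 u2 v2 where "U = {u1, u2}" "V = {u1, v2}" "u1 \<noteq> u2" "u1 \<noteq> v2" "u2 \<noteq> v2"
    | u1 u2 v1 v2 where "U = {u1, u2}" "V = {v1, v2}" "u1 \<noteq> u2" "v1 \<noteq> v2" "{u1, u2} \<inter> {v1, v2} = {}"
  proof -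
    show thesis
    proof (cases "U \<inter> V = {}")
      case True
      then show thesis using U V that(3) by (auto simp: card_2_iff)
    next
      case False
      then obtain c where c: "c \<in> U" "c \<in> V" by blast
      obtain u where u: "U = {c, u}" "c \<noteq> u" using U c by (auto simp: card_2_iff)
      obtain v where v: "V = {c, v}" "c \<noteq> v" using V c by (auto simp: card_2_iff)
      show thesis
        using that(1) that(2)[of c u v] u v by blast
    qed
  qed
  then show ?thesis
  proof cases
    case 1
    obtain u1 u2 where u: "U = {u1, u2}" "u1 \<noteq> u2" using U by (auto simp: card_2_iff)
    have "P u1 u1 \<ge> 1" "P u2 u2 \<ge> 1" by (auto intro: P1)
    then show ?thesis using sum[of u1 u2 u1 u2] u 1 P0[of u1 u2] P0[of u2 u1] by simp
  next
    case 2
    \<comment> \<open>If all middle lists contain \<open>u1\<close>, none of them is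
      \<open>{u2, v2}\<close> and both products are positive. Otherwise some middle vertex has two
      colors available when both ends have color \<open>u1\<close>.\<close>
    have "P u1 u1 + P u2 v2 \<ge> 2"
    proof (cases "\<forall>X\<in>{A, B, C}. u1 \<in> X")
      case True
      then have "P u2 v2 \<ge> 1" using 2 by (intro P1) auto
      moreover have "P u1 u1 \<ge> 1" by (rule P1) auto
      ultimately show ?thesis by simp
    next
      case False
      have ge: "num_path u1 [X] u1 \<ge> 1 + of_bool (u1 \<notin> X)" if "X \<in> {A, B, C}" for X
        using As that by (auto simp: num_path_single card_Diff_singleton_if)
      have "P u1 u1 \<ge> 2"
      proof -
        have "P u1 u1 \<ge> (1 + of_bool (u1 \<notin> A)) * (1 + of_bool (u1 \<notin> B)) * (1 + of_bool (u1 \<notin> C))"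
          unfolding P_def by (intro mult_mono ge) auto
        with False show ?thesis by (auto simp: of_bool_def split: if_splits)
      qed
      then show ?thesis using P0[of u2 v2] by simp
    qed
    then show ?thesis using sum[of u1 u2 u1 v2] 2 P0[of u1 v2] P0[of u2 u1] by simp
  next
    case 3
    have A: "P u1 v1 + P u2 v2 \<ge> 2" if "P u1 v1 \<noteq> 0 \<or> P u2 v2 \<noteq> 0"
      unfolding P_def by (rule opposite_products) (use that 3 in \<open>auto simp: P_def intro!: opp\<close>)
    have B: "P u1 v2 + P u2 v1 \<ge> 2" if "P u1 v2 \<noteq> 0 \<or> P u2 v1 \<noteq> 0"
      unfolding P_def by (rule opposite_products) (use that 3 in \<open>auto simp: P_def intro!: opp\<close>)
    \<comment> \<open>A pair with vanishing product must be one of the middle lists, but there are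
      four pairs and only three lists.\<close>
    have "\<not> (P u1 v1 = 0 \<and> P u2 v2 = 0 \<and> P u1 v2 = 0 \<and> P u2 v1 = 0)"
    proof
      assume *: "P u1 v1 = 0 \<and> P u2 v2 = 0 \<and> P u1 v2 = 0 \<and> P u2 v1 = 0"
      have "P a b = 0 \<Longrightarrow> {a, b} \<in> {A, B, C}" for a b
        using num_path_single_eq_0 As unfolding P_def by auto
      then have "{{u1, v1}, {u2, v2}, {u1, v2}, {u2, v1}} \<subseteq> {A, B, C}"
        using * by blast
      then have "card {{u1, v1}, {u2, v2}, {u1, v2}, {u2, v1}} \<le> card {A, B, C}"
        by (intro card_mono) auto
      moreover have "card {A, B, C} \<le> 3" by (simp add: card_insert_if)
      moreover have "card {{u1, v1}, {u2, v2}, {u1, v2}, {u2, v1}} = 4"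
        using 3 by (auto simp: card_insert_if doubleton_eq_iff)
      ultimately show False by simp
    qed
    then show ?thesis
      using A B 3 sum[of u1 u2 v1 v2] P0[of u1 v1] P0[of u1 v2] P0[of u2 v1] P0[of u2 v2] by force
  qed
qed

section \<open>Small numbers of colors and mixed parities\<close>

lemma theta_poly_0 [simp]: "theta_poly 0 i j k = 0"
  by (simp add: theta_poly_def)

lemma theta_poly_1: "i \<ge> 1 \<Longrightarrow> theta_poly (Suc 0) i j k = 0"
  using offdiag_mult[of "Suc 0" i] by (simp add: theta_poly_def)

lemma offdiag_2: "offdiag 2 l = of_bool (odd l)"
  by (induction l) auto

text \<open>A theta graph is connected, and it is bipartite if and only if its three lengths have
  the same parity.\<close>

lemma theta_poly_2:
  "theta_poly 2 i j k = (if even i = even j \<and> even j = even k then 2 else 0)"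
  by (auto simp: theta_poly_def offdiag_2)

lemma theta_sum_nonneg: "theta_sum U V As Bs Cs \<ge> 0"
  unfolding theta_sum_def by (intro sum_nonneg mult_nonneg_nonneg) auto

text \<open>Mixed parities give an odd cycle, so at most two colors admit no proper coloring. For
  more colors the paths are permuted until one of the two bounds applies. As \<open>Bs\<close> and
  \<open>Cs\<close> are nonempty, two odd paths form a cycle and not a double edge.\<close>

lemma theta_mixed_parity_bound:
  assumes "uniform_lists m As" "uniform_lists m Bs" "uniform_lists m Cs"
    and "Bs \<noteq> []" "Cs \<noteq> []"
    and U: "finite U" "card U = m" and V: "finite V" "card V = m"
    and "\<not> (even (length As) = even (length Bs) \<and> even (length Bs) = even (length Cs))"
  shows "theta_sum U V As Bs Cs \<ge> theta_poly m (Suc (length As)) (Suc (length Bs)) (Suc (length Cs))"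
proof (cases "m \<ge> 3")
  case False
  have "theta_poly m (Suc (length As)) (Suc (length Bs)) (Suc (length Cs)) = 0"
    using False assms less_Suc_eq[of m 2] less_2_cases_iff[of m]
    by (auto simp: theta_poly_1 theta_poly_2)
  then show ?thesis using theta_sum_nonneg by simp
next
  case m: True
  note E = theta_even_even_odd_bound[OF m _ _ _ _ _ _ U V]
  note O = theta_even_odd_odd_bound[OF m _ _ _ _ _ _ _ U V]
  consider "odd (length As)" "odd (length Bs)" "even (length Cs)"
    | "odd (length As)" "even (length Bs)" "odd (length Cs)"
    | "even (length As)" "odd (length Bs)" "odd (length Cs)"
    | "odd (length As)" "even (length Bs)" "even (length Cs)"
    | "even (length As)" "odd (length Bs)" "even (length Cs)"
    | "even (length As)" "even (length Bs)" "odd (length Cs)"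
    using assms by blast
  then show ?thesis
  proof cases
    case 1
    then show ?thesis using E[of As Bs Cs] assms by blast
  next
    case 2
    then show ?thesis using E[of As Cs Bs] assms theta_sum_perm theta_poly_perm by metis
  next
    case 3
    then show ?thesis using E[of Bs Cs As] assms theta_sum_perm theta_poly_perm by metis
  next
    case 4
    then show ?thesis using O[of As Bs Cs] assms by simp
  next
    case 5
    then show ?thesis using O[of Bs As Cs] assms theta_sum_perm(1) theta_poly_perm(1)
      by (metis add_gr_0 length_greater_0_conv)
  next
    case 6
    then show ?thesis using O[of Cs As Bs] assms theta_sum_perm theta_poly_perm
      by (metis add_gr_0 length_greater_0_conv)
  qed
qed

lemma theta_2_2_2_choosable:
  assumes "uniform_lists m [A, B, C]"
    and "finite U" "card U = m" "finite V" "card V = m"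
  shows "theta_sum U V [A] [B] [C] \<ge> theta_poly m 2 2 2"
proof (cases "m \<ge> 3")
  case False
  consider "m = 0" | "m = 1" | "m = 2" using False by linarith
  then show ?thesis
  proof cases
    case 3
    then show ?thesis using theta_2_2_2_bound_two[of A B C U V] assms by (simp add: theta_poly_2)
  qed (use theta_sum_nonneg in \<open>auto simp: theta_poly_1\<close>)
qed (use theta_2_2_2_bound assms in blast)

section \<open>Colorings of theta graphs\<close>

lemma map_nth_pred: "length xs = n - 1 \<Longrightarrow> map (\<lambda>j. xs ! (j - 1)) [1..<n] = xs"
  by (intro nth_equalityI) auto

text \<open>Relates the list of internal colors to a function \<open>g\<close> on the positions
  \<open>0\<close> to \<open>l\<close>, whose values at \<open>0\<close> and \<open>l\<close> are
  the end colors.\<close>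

lemma map_upt_path_colorings:
  assumes "l \<ge> 1"
  shows "map g [1..<l] \<in> path_colorings (g 0) (map M [1..<l]) (g l) \<longleftrightarrow>
    (\<forall>j\<in>{1..<l}. g j \<in> M j) \<and> (\<forall>j<l. g j \<noteq> g (Suc j))"
proof -
  have "g 0 # map g [1..<l] @ [g l] = map g [0..<Suc l]"
    using assms by (simp add: upt_rec[of 0])
  moreover have "successively (\<noteq>) (map g [0..<Suc l]) \<longleftrightarrow> (\<forall>j<l. g j \<noteq> g (Suc j))"
    by (auto simp: successively_conv_nth simp del: upt_Suc)
  ultimately show ?thesis
    by (auto simp: path_colorings_def list.rel_map list_all2_same)
qed

lemma card_Sigma_Sigma:
  assumes "finite A" "finite B" "\<And>a b. finite (Q a b)"
  shows "card (SIGMA a:A. SIGMA b:B. Q a b) = (\<Sum>a\<in>A. \<Sum>b\<in>B. card (Q a b))"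
  using assms by simp

context
  fixes l1 l2 l3 :: nat
  assumes pos: "l1 \<ge> 1" "l2 \<ge> 1" "l3 \<ge> 1"
begin

abbreviation (input) "len \<equiv> theta_len l1 l2 l3"
abbreviation (input) "path L i \<equiv> map (\<lambda>j. L (i, j)) [1..<len i]"

lemma theta_proper_iff:
  "(\<forall>u\<in>theta_V l1 l2 l3. \<forall>v\<in>theta_V l1 l2 l3. theta_E l1 l2 l3 u v \<longrightarrow> f u \<noteq> f v) \<longleftrightarrow>
    (\<forall>i\<in>{1,2,3}. \<forall>j<len i. f (theta_pv l1 l2 l3 i j) \<noteq> f (theta_pv l1 l2 l3 i (Suc j)))"
    (is "?lhs \<longleftrightarrow> ?rhs")
proof
  assume lhs: ?lhs
  have V: "theta_pv l1 l2 l3 i j \<in> theta_V l1 l2 l3" if "i \<in> {1,2,3}" "j \<le> len i" for i j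
    using that by (auto simp: theta_pv_def theta_V_def)
  have E: "theta_E l1 l2 l3 (theta_pv l1 l2 l3 i j) (theta_pv l1 l2 l3 i (Suc j))"
    if "i \<in> {1,2,3}" "j < len i" for i j
    unfolding theta_E_def using that by blast
  show ?rhs using lhs V E by (meson Suc_leI less_imp_le)
next
  assume ?rhs
  then show ?lhs unfolding theta_E_def by metis
qed

lemma proper_theta_iff:
  "f \<in> proper_L_colorings (theta_V l1 l2 l3) (theta_E l1 l2 l3) L \<longleftrightarrow>
    f (0, 0) \<in> L (0, 0) \<and> f (0, 1) \<in> L (0, 1) \<and>
    (\<forall>i\<in>{1,2,3}. path f i \<in> path_colorings (f (0, 0)) (path L i) (f (0, 1))) \<and>
    (\<forall>v. v \<notin> theta_V l1 l2 l3 \<longrightarrow> f v = undefined)"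
proof -
  have path: "path f i \<in> path_colorings (f (0, 0)) (path L i) (f (0, 1)) \<longleftrightarrow>
      (\<forall>j\<in>{1..<len i}. f (i, j) \<in> L (i, j)) \<and>
      (\<forall>j<len i. f (theta_pv l1 l2 l3 i j) \<noteq> f (theta_pv l1 l2 l3 i (Suc j)))" for i
  proof -
    have len: "len i \<ge> 1" using pos by (simp add: theta_len_def)
    \<comment> \<open>\<open>theta_pv\<close> maps the first and the last position to the common
      ends, so \<open>g\<close> reads \<open>f\<close> along the path with both ends
      included.\<close>
    define g where "g j = f (theta_pv l1 l2 l3 i j)" for j
    have g: "g 0 = f (0, 0)" "g (len i) = f (0, 1)" "\<And>j. j \<in> {1..<len i} \<Longrightarrow> g j = f (i, j)"
      using len by (auto simp: g_def theta_pv_def)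
    have "path f i = map g [1..<len i]"
      using g(3) by simp
    then have "path f i \<in> path_colorings (f (0, 0)) (path L i) (f (0, 1)) \<longleftrightarrow>
        (\<forall>j\<in>{1..<len i}. g j \<in> L (i, j)) \<and> (\<forall>j<len i. g j \<noteq> g (Suc j))"
      by (simp only: map_upt_path_colorings[OF len] flip: g(1,2))
    also have "(\<forall>j\<in>{1..<len i}. g j \<in> L (i, j)) \<longleftrightarrow> (\<forall>j\<in>{1..<len i}. f (i, j) \<in> L (i, j))"
      using g(3) by simp
    finally show ?thesis by (simp add: g_def)
  qed
  have "(\<forall>v\<in>theta_V l1 l2 l3. f v \<in> L v) \<longleftrightarrow> f (0, 0) \<in> L (0, 0) \<and> f (0, 1) \<in> L (0, 1) \<and>
      (\<forall>i\<in>{1,2,3}. \<forall>j\<in>{1..<len i}. f (i, j) \<in> L (i, j))"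
    by (auto simp: theta_V_def)
  then show ?thesis
    unfolding proper_L_colorings_def mem_Collect_eq theta_proper_iff path by blast
qed

text \<open>Once the ends are colored, the three paths are colored independently. The bijection
  \<open>F\<close> records the end colors and the three sequences of internal colors.\<close>

lemma num_L_colorings_theta:
  assumes "uniform_lists m (path L 1)" "uniform_lists m (path L 2)" "uniform_lists m (path L 3)"
    and fin: "finite (L (0, 0))" "finite (L (0, 1))"
  shows "int (num_L_colorings (theta_V l1 l2 l3) (theta_E l1 l2 l3) L) =
    theta_sum (L (0, 0)) (L (0, 1)) (path L 1) (path L 2) (path L 3)"
proof -
  let ?P = "\<lambda>i a b. path_colorings a (path L i) b"
  define T where "T = (SIGMA a:L (0, 0). SIGMA b:L (0, 1). ?P 1 a b \<times> ?P 2 a b \<times> ?P 3 a b)"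
  define F where "F f = (f (0, 0), f (0, 1), path f 1, path f 2, path f 3)"
    for f :: "nat \<times> nat \<Rightarrow> nat"
  \<comment> \<open>The inverse of \<open>F\<close>. The first internal vertex has index
    \<open>1\<close>, whence \<open>j - 1\<close>; outside the vertex set the value is
    \<open>undefined\<close>, as for every element of \<open>proper_L_colorings\<close>.\<close>
  define G where "G = (\<lambda>(a, b, xs, ys, zs) (i, j).
      if (i, j) \<notin> theta_V l1 l2 l3 then undefined else if i = 0 then (if j = 0 then a else b)
      else (if i = 1 then xs else if i = 2 then ys else zs) ! (j - 1) :: nat)"
  have len_path: "length xs = len i - 1" if "xs \<in> ?P i a b" for xs i a b
    using that by (auto simp: path_colorings_def dest: list_all2_lengthD)
  have FG: "F (G t) = t" if "t \<in> T" for t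
  proof -
    obtain a b xs ys zs where t: "t = (a, b, xs, ys, zs)" by (cases t) auto
    with that have P: "xs \<in> ?P 1 a b" "ys \<in> ?P 2 a b" "zs \<in> ?P 3 a b" by (auto simp: T_def)
    have "path (G t) 1 = xs"
      by (subst map_nth_pred[OF len_path[OF P(1)], symmetric]) (auto simp: G_def t theta_V_def)
    moreover have "path (G t) 2 = ys"
      by (subst map_nth_pred[OF len_path[OF P(2)], symmetric]) (auto simp: G_def t theta_V_def)
    moreover have "path (G t) 3 = zs"
      by (subst map_nth_pred[OF len_path[OF P(3)], symmetric]) (auto simp: G_def t theta_V_def)
    ultimately show ?thesis by (simp add: F_def) (simp add: G_def t theta_V_def)
  qed
  have GF: "G (F f) = f" if "\<forall>v. v \<notin> theta_V l1 l2 l3 \<longrightarrow> f v = undefined" for f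
  proof
    fix v :: "nat \<times> nat"
    obtain i j where v: "v = (i, j)" by (cases v)
    show "G (F f) v = f v"
    proof (cases "v \<in> theta_V l1 l2 l3")
      case True
      then consider "i = 0" "j = 0" | "i = 0" "j = 1" | "i \<in> {1, 2, 3}" "0 < j" "j < len i"
        by (auto simp: v theta_V_def)
      then show ?thesis
        by cases (use True in \<open>auto simp: v G_def F_def\<close>)
    qed (use that in \<open>auto simp: v G_def F_def\<close>)
  qed
  have "bij_betw F (proper_L_colorings (theta_V l1 l2 l3) (theta_E l1 l2 l3) L) T"
  proof (rule bij_betw_byWitness[where f' = G])
    show "\<forall>f\<in>proper_L_colorings (theta_V l1 l2 l3) (theta_E l1 l2 l3) L. G (F f) = f"
    proof
      fix f assume "f \<in> proper_L_colorings (theta_V l1 l2 l3) (theta_E l1 l2 l3) L"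
      then show "G (F f) = f" unfolding proper_theta_iff by (intro GF) blast
    qed
    show "\<forall>t\<in>T. F (G t) = t" using FG by blast
    show "F ` proper_L_colorings (theta_V l1 l2 l3) (theta_E l1 l2 l3) L \<subseteq> T"
    proof (rule image_subsetI)
      fix f assume "f \<in> proper_L_colorings (theta_V l1 l2 l3) (theta_E l1 l2 l3) L"
      then show "F f \<in> T" unfolding proper_theta_iff F_def T_def by blast
    qed
    show "G ` T \<subseteq> proper_L_colorings (theta_V l1 l2 l3) (theta_E l1 l2 l3) L"
    proof (rule image_subsetI)
      fix t assume "t \<in> T"
      define f where "f = G t"
      have "F f \<in> T" unfolding f_def using FG[OF \<open>t \<in> T\<close>] \<open>t \<in> T\<close> by simp
      moreover have "\<forall>v. v \<notin> theta_V l1 l2 l3 \<longrightarrow> f v = undefined"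
        by (auto simp: f_def G_def split: prod.splits)
      ultimately have "f \<in> proper_L_colorings (theta_V l1 l2 l3) (theta_E l1 l2 l3) L"
        unfolding proper_theta_iff F_def T_def by blast
      then show "G t \<in> proper_L_colorings (theta_V l1 l2 l3) (theta_E l1 l2 l3) L"
        by (simp add: f_def)
    qed
  qed
  then have "num_L_colorings (theta_V l1 l2 l3) (theta_E l1 l2 l3) L = card T"
    unfolding num_L_colorings_def by (rule bij_betw_same_card)
  also have "card T = (\<Sum>a\<in>L (0, 0). \<Sum>b\<in>L (0, 1). card (?P 1 a b \<times> ?P 2 a b \<times> ?P 3 a b))"
  proof -
    have "finite (?P 1 a b \<times> ?P 2 a b \<times> ?P 3 a b)" for a b
      by (intro finite_cartesian_product finite_path_colorings[OF assms(1)]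
          finite_path_colorings[OF assms(2)] finite_path_colorings[OF assms(3)])
    then show ?thesis
      unfolding T_def by (rule card_Sigma_Sigma[OF fin])
  qed
  finally have card: "num_L_colorings (theta_V l1 l2 l3) (theta_E l1 l2 l3) L = \<dots>" .
  show ?thesis
    unfolding card theta_sum_def num_path_def
    by (simp only: card_cartesian_product of_nat_sum of_nat_mult mult.assoc)
qed

end

lemma theta_sum_replicate:
  assumes "finite M" "card M = m"
  shows "theta_sum M M (replicate i M) (replicate j M) (replicate k M) =
    theta_poly m (Suc i) (Suc j) (Suc k)"
proof -
  define s where "s n = (- 1 :: int) ^ Suc n" for n :: nat
  define p where "p n = offdiag m (Suc n)" for n
  have "theta_sum M M (replicate i M) (replicate j M) (replicate k M) =
    (\<Sum>a\<in>M. \<Sum>b\<in>M. p i * p j * p k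
      + of_bool (a = b \<and> a \<in> M) * ((p i + s i) * (p j + s j) * (p k + s k) - p i * p j * p k))"
    unfolding theta_sum_def using assms
    by (intro sum.cong refl) (auto simp: num_path_replicate p_def s_def simp del: offdiag.simps)
  also have "\<dots> = int m * int m * (p i * p j * p k)
      + int (card M) * ((p i + s i) * (p j + s j) * (p k + s k) - p i * p j * p k)"
    using sum_sum_delta[of M M M "(p i + s i) * (p j + s j) * (p k + s k) - p i * p j * p k"] assms
    by (simp only: sum.distrib sum_constant) simp
  also have "\<dots> = theta_poly m (Suc i) (Suc j) (Suc k)"
    unfolding theta_poly_def p_def[symmetric] s_def[symmetric] using assms by (simp add: algebra_simps)
  finally show ?thesis .
qed

section \<open>Choosability as an inequality between color counts\<close>

text \<open>The set under \<open>Min\<close> is finite, as the counts are at most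
  \<open>m ^ card V\<close>, and it contains \<open>chrom_poly\<close>, the count of the constant
  assignment. Hence equality says that \<open>chrom_poly\<close> is a lower bound.\<close>

lemma enum_chromatic_choosable_iff:
  assumes "finite V"
  shows "enum_chromatic_choosable V E \<longleftrightarrow>
    (\<forall>m L. m_assignment V m L \<longrightarrow> chrom_poly V E m \<le> num_L_colorings V E L)"
proof -
  have "list_color_fun V E m = chrom_poly V E m \<longleftrightarrow>
      (\<forall>L. m_assignment V m L \<longrightarrow> chrom_poly V E m \<le> num_L_colorings V E L)" for m
  proof -
    let ?S = "{num_L_colorings V E L | L. m_assignment V m L}"
    have "num_L_colorings V E L \<le> m ^ card V" if "m_assignment V m L" for L
    proof -
      have "proper_L_colorings V E L \<subseteq> PiE V L"
        by (auto simp: proper_L_colorings_def PiE_def extensional_def)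
      moreover have "finite (PiE V L)"
        using that assms by (auto simp: m_assignment_def intro!: finite_PiE)
      ultimately have "card (proper_L_colorings V E L) \<le> card (PiE V L)"
        by (rule card_mono[rotated])
      also have "\<dots> = m ^ card V"
        using that assms by (simp add: m_assignment_def card_PiE)
      finally show ?thesis by (simp add: num_L_colorings_def)
    qed
    then have "?S \<subseteq> {..m ^ card V}" by auto
    then have fin: "finite ?S" by (rule finite_subset) simp
    have mem: "chrom_poly V E m \<in> ?S"
      unfolding chrom_poly_def by (auto simp: m_assignment_def intro!: exI[of _ "\<lambda>_. {1..m}"])
    then have "?S \<noteq> {}" by blast
    then show ?thesis
      unfolding list_color_fun_def Min_eq_iff[OF fin \<open>?S \<noteq> {}\<close>] using mem by blast
  qed
  then show ?thesis unfolding enum_chromatic_choosable_def by blast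
qed

lemma finite_theta_V: "finite (theta_V l1 l2 l3)"
proof (rule finite_subset)
  show "theta_V l1 l2 l3 \<subseteq> {0..3} \<times> {0..l1 + l2 + l3 + 1}"
    by (auto simp: theta_V_def theta_len_def split: if_splits)
qed simp

text \<open>An \<open>m\<close>-assignment of a theta graph amounts to two end lists and three
  sequences of internal lists; this separates the estimates from the encoding of the graph.\<close>

lemma enum_chromatic_choosable_theta_iff:
  assumes pos: "l1 \<ge> 1" "l2 \<ge> 1" "l3 \<ge> 1"
  shows "enum_chromatic_choosable (theta_V l1 l2 l3) (theta_E l1 l2 l3) \<longleftrightarrow>
    (\<forall>m U V As Bs Cs. finite U \<and> card U = m \<and> finite V \<and> card V = m \<and>
       uniform_lists m As \<and> uniform_lists m Bs \<and> uniform_lists m Cs \<and>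
       Suc (length As) = l1 \<and> Suc (length Bs) = l2 \<and> Suc (length Cs) = l3 \<longrightarrow>
       theta_poly m l1 l2 l3 \<le> theta_sum U V As Bs Cs)"
    (is "?choosable \<longleftrightarrow> ?bound")
proof -
  let ?V = "theta_V l1 l2 l3" and ?E = "theta_E l1 l2 l3"
  let ?path = "\<lambda>L i. map (\<lambda>j. L (i, j)) [1..<theta_len l1 l2 l3 i]"
  have unif: "uniform_lists m (?path L i)" if "m_assignment ?V m L" "i \<in> {1, 2, 3}" for m L i
    using that by (auto simp: m_assignment_def theta_V_def uniform_lists_def)
  have ends: "finite (L (0, 0)) \<and> card (L (0, 0)) = m \<and> finite (L (0, 1)) \<and> card (L (0, 1)) = m"
    if "m_assignment ?V m L" for m L
    using that by (simp add: m_assignment_def theta_V_def)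
  have num: "int (num_L_colorings ?V ?E L) =
      theta_sum (L (0, 0)) (L (0, 1)) (?path L 1) (?path L 2) (?path L 3)"
    if "m_assignment ?V m L" for m L
    by (rule num_L_colorings_theta[OF pos, where m = m]) (use unif[OF that] ends[OF that] in blast)+
  have chrom: "int (chrom_poly ?V ?E m) = theta_poly m l1 l2 l3" for m
    using num[of m "\<lambda>_. {1..m}"] pos theta_sum_replicate[of "{1..m}" m "l1 - 1" "l2 - 1" "l3 - 1"]
    by (simp add: m_assignment_def chrom_poly_def map_replicate_const theta_len_def)
  show ?thesis
  proof
    assume ch: ?choosable
    show ?bound
    proof (intro allI impI, elim conjE)
      fix m and U V :: "nat set" and As Bs Cs :: "nat set list"
      assume U: "finite U" "card U = m" and V: "finite V" "card V = m"
        and Ls: "uniform_lists m As" "uniform_lists m Bs" "uniform_lists m Cs"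
        and len: "Suc (length As) = l1" "Suc (length Bs) = l2" "Suc (length Cs) = l3"
      define L where "L = (\<lambda>(i :: nat, j). if i = 0 then (if j = 0 then U else V) else
          (if i = 1 then As else if i = 2 then Bs else Cs) ! (j - (1::nat)))"
      have nth: "finite (Xs ! (j - 1)) \<and> card (Xs ! (j - 1)) = m"
        if "uniform_lists m Xs" "0 < j" "j < Suc (length Xs)" for Xs j
        using that by (auto simp: uniform_lists_def)
      have L: "m_assignment ?V m L"
        unfolding m_assignment_def
      proof
        fix v assume "v \<in> ?V"
        then consider "v = (0, 0)" | "v = (0, 1)"
          | j where "v = (1, j)" "0 < j" "j < Suc (length As)"
          | j where "v = (2, j)" "0 < j" "j < Suc (length Bs)"
          | j where "v = (3, j)" "0 < j" "j < Suc (length Cs)"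
          unfolding theta_V_def theta_len_def len by fastforce
        then show "finite (L v) \<and> card (L v) = m"
          by cases (use U V nth[OF Ls(1)] nth[OF Ls(2)] nth[OF Ls(3)] in \<open>simp_all add: L_def\<close>)
      qed
      have path: "?path L 1 = As" "?path L 2 = Bs" "?path L 3 = Cs"
        using map_nth_pred[of As l1] map_nth_pred[of Bs l2] map_nth_pred[of Cs l3] len
        by (simp_all add: L_def theta_len_def)
      have "chrom_poly ?V ?E m \<le> num_L_colorings ?V ?E L"
        using ch L unfolding enum_chromatic_choosable_iff[OF finite_theta_V] by blast
      then have "theta_poly m l1 l2 l3 \<le> int (num_L_colorings ?V ?E L)"
        using chrom[of m] by linarith
      then show "theta_poly m l1 l2 l3 \<le> theta_sum U V As Bs Cs"
        unfolding num[OF L] path by (simp add: L_def)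
    qed
  next
    assume b: ?bound
    have "chrom_poly ?V ?E m \<le> num_L_colorings ?V ?E L" if L: "m_assignment ?V m L" for m L
    proof -
      have "theta_poly m l1 l2 l3 \<le> theta_sum (L (0, 0)) (L (0, 1)) (?path L 1) (?path L 2) (?path L 3)"
        using unif[OF L, of 1] unif[OF L, of 2] unif[OF L, of 3] ends[OF L] pos
        by (intro b[rule_format, of _ m]) (simp add: theta_len_def)
      then show ?thesis using num[OF L] chrom[of m] by linarith
    qed
    then show ?choosable
      unfolding enum_chromatic_choosable_iff[OF finite_theta_V] by blast
  qed
qed

section \<open>Theta graphs with paths of the same parity\<close>

text \<open>With \<open>U = {a, c}\<close> the two vertices after the end of color \<open>a\<close>
  are forced to have the colors \<open>c\<close> and \<open>a\<close>, so the rest of the path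
  starts at \<open>a\<close> again.\<close>

lemma num_path_two_step:
  assumes "finite U" "card U = 2" "a \<in> U" "uniform_lists m As"
  shows "num_path a (U # U # As) b = num_path a As b"
proof -
  obtain c where U: "U = {a, c}" "a \<noteq> c" using assms by (auto simp: card_2_iff)
  then have "U - {a, a} = {c}" "U - {a, c} = {}" by auto
  then show ?thesis
    using assms(4) U by (subst num_path_Cons_Cons[where m = m]) auto
qed

lemma num_path_pad:
  assumes "finite U" "card U = 2" "a \<in> U" "uniform_lists 2 As"
  shows "num_path a (replicate (2 * n) U @ As) b = num_path a As b"
proof (induction n)
  case (Suc n)
  have "uniform_lists 2 (replicate (2 * n) U @ As)"
    using assms by (auto simp: uniform_lists_def)
  then show ?case using Suc num_path_two_step[OF assms(1-3)] by simp
qed simp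

lemma theta_sum_pad:
  assumes "finite U" "card U = 2" "uniform_lists 2 As" "uniform_lists 2 Bs" "uniform_lists 2 Cs"
  shows "theta_sum U V (replicate (2 * i) U @ As) (replicate (2 * j) U @ Bs) (replicate (2 * k) U @ Cs)
    = theta_sum U V As Bs Cs"
  unfolding theta_sum_def using assms by (intro sum.cong refl) (simp add: num_path_pad)

text \<open>The edge excludes equal end colors. For end colors \<open>1\<close>, \<open>2\<close>
  the second path is forced to \<open>3\<close>, \<open>2\<close> and fails at its end; for
  \<open>2\<close>, \<open>1\<close> the third is forced to \<open>3\<close>, \<open>1\<close> and
  fails.\<close>

lemma theta_sum_1_3_3: "theta_sum {1, 2} {1, 2} [] [{1, 3}, {2, 3}] [{2, 3}, {1, 3}] = 0"
  by (simp add: theta_sum_def num_path_Cons'[where m = 2])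

text \<open>The end colors \<open>(2, 1)\<close>, \<open>(2, 3)\<close> and \<open>(1, 1)\<close>
  are excluded by the first, second and third path, respectively. For \<open>(1, 3)\<close> all
  three paths are forced.\<close>

lemma theta_sum_2_2_4:
  "theta_sum {1, 2} {1, 3} [{1, 2}] [{2, 3}] [{1, 2}, {2, 3}, {1, 3}] = 1"
  by (simp add: theta_sum_def num_path_Cons'[where m = 2])

text \<open>Padding with \<open>U\<close> extends a 2-assignment with fewer than two colorings to
  longer paths of the same parities, while the chromatic polynomial at \<open>2\<close> is still
  \<open>2\<close>.\<close>

lemma not_enum_chromatic_choosable_theta:
  assumes "l1 \<ge> 1" "l2 \<ge> 1" "l3 \<ge> 1" "even l1 = even l2" "even l2 = even l3"
    and "finite U" "card U = 2" "finite V" "card V = 2"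
    and Ls: "uniform_lists 2 As" "uniform_lists 2 Bs" "uniform_lists 2 Cs"
    and "theta_sum U V As Bs Cs < 2"
    and "Suc (length As) \<le> l1" "Suc (length Bs) \<le> l2" "Suc (length Cs) \<le> l3"
    and "odd (length As) = even l1" "odd (length Bs) = even l2" "odd (length Cs) = even l3"
  shows "\<not> enum_chromatic_choosable (theta_V l1 l2 l3) (theta_E l1 l2 l3)"
proof -
  have pad: "\<exists>n. Suc (length Xs) + 2 * n = l" if "Suc (length Xs) \<le> l" "odd (length Xs) = even l"
    for Xs :: "nat set list" and l
  proof -
    have "even (l - Suc (length Xs))" using that by simp
    then obtain n where "l - Suc (length Xs) = 2 * n" by (elim evenE)
    then show ?thesis using that by (intro exI[of _ n]) simp
  qed
  obtain i j k where ijk: "Suc (length As) + 2 * i = l1" "Suc (length Bs) + 2 * j = l2"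
    "Suc (length Cs) + 2 * k = l3"
    using pad assms by metis
  have "theta_sum U V (replicate (2 * i) U @ As) (replicate (2 * j) U @ Bs) (replicate (2 * k) U @ Cs)
      < theta_poly 2 l1 l2 l3"
    using assms by (simp add: theta_sum_pad theta_poly_2)
  moreover have "uniform_lists 2 (replicate n U)" for n
    using assms by (simp add: uniform_lists_def)
  ultimately show ?thesis
    unfolding enum_chromatic_choosable_theta_iff[OF assms(1-3)] not_all
    using assms ijk
    by (intro exI[of _ 2] exI[of _ U] exI[of _ V] exI[of _ "replicate (2 * i) U @ As"]
        exI[of _ "replicate (2 * j) U @ Bs"] exI[of _ "replicate (2 * k) U @ Cs"]) simp
qed

theorem theorem1p4:
  fixes l1 l2 l3 :: nat
  assumes "l1 \<ge> 1" "l1 = Min {l1, l2, l3}" "l2 \<ge> 2" "l3 \<ge> 2"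
  shows "\<not> enum_chromatic_choosable (theta_V l1 l2 l3) (theta_E l1 l2 l3) \<longleftrightarrow>
           ((even l1 \<longleftrightarrow> even l2) \<and> (even l2 \<longleftrightarrow> even l3) \<and> {l1, l2, l3} \<noteq> {2})"
proof
  assume not_choosable: "\<not> enum_chromatic_choosable (theta_V l1 l2 l3) (theta_E l1 l2 l3)"
  have "l2 \<ge> 1" "l3 \<ge> 1" using assms by auto
  from not_choosable obtain m U V As Bs Cs where U: "finite U" "card U = m" and V: "finite V" "card V = m"
    and Ls: "uniform_lists m As" "uniform_lists m Bs" "uniform_lists m Cs"
    and len: "Suc (length As) = l1" "Suc (length Bs) = l2" "Suc (length Cs) = l3"
    and less: "\<not> theta_poly m l1 l2 l3 \<le> theta_sum U V As Bs Cs"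
    unfolding enum_chromatic_choosable_theta_iff[OF assms(1) \<open>l2 \<ge> 1\<close> \<open>l3 \<ge> 1\<close>] by blast
  have "Bs \<noteq> []" "Cs \<noteq> []" using assms len by auto
  then have "(even l1 \<longleftrightarrow> even l2) \<and> (even l2 \<longleftrightarrow> even l3)"
    using theta_mixed_parity_bound[OF Ls _ _ U V] less unfolding len[symmetric] by auto
  moreover have "{l1, l2, l3} \<noteq> {2}"
  proof
    assume "{l1, l2, l3} = {2}"
    then have l: "l1 = 2" "l2 = 2" "l3 = 2" by auto
    then obtain A B C where "As = [A]" "Bs = [B]" "Cs = [C]"
      using len by (auto simp: length_Suc_conv numeral_2_eq_2)
    then show False using theta_2_2_2_choosable[OF _ U V, of A B C] Ls less l by simp
  qed
  ultimately show "(even l1 \<longleftrightarrow> even l2) \<and> (even l2 \<longleftrightarrow> even l3) \<and> {l1, l2, l3} \<noteq> {2}"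
    by blast
next
  assume par: "(even l1 \<longleftrightarrow> even l2) \<and> (even l2 \<longleftrightarrow> even l3) \<and> {l1, l2, l3} \<noteq> {2}"
  have min: "l1 \<le> l2" "l1 \<le> l3" using assms(2) by (metis Min_le finite.emptyI finite.insertI insertCI)+
  have two: "card {1, 2 :: nat} = 2" "card {1, 3 :: nat} = 2" "card {2, 3 :: nat} = 2" by auto
  note not_choosable = not_enum_chromatic_choosable_theta[of l1 l2 l3]
  show "\<not> enum_chromatic_choosable (theta_V l1 l2 l3) (theta_E l1 l2 l3)"
  proof (cases "even l1")
    case False
    then have "odd l2" "odd l3" using par by auto
    \<comment> \<open>The lengths thus arise from 1, 3, 3 by padding.\<close>
    then have "l2 \<ge> 3" "l3 \<ge> 3" using assms(3,4) by presburger+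
    then show ?thesis
      using not_choosable[of "{1, 2}" "{1, 2}" "[]" "[{1, 3}, {2, 3}]" "[{2, 3}, {1, 3}]"]
        theta_sum_1_3_3 assms False par by simp
  next
    case True
    have ev: "even l2" "even l3" using True par by auto
    have "l1 \<ge> 2" using True assms(1) by presburger
    \<comment> \<open>As \<open>l1\<close> is the minimum, \<open>l2 = l3 = 2\<close> would force
      \<open>l1 = 2\<close>, the excluded case.\<close>
    have "l2 \<noteq> 2 \<or> l3 \<noteq> 2"
    proof (rule ccontr)
      assume "\<not> (l2 \<noteq> 2 \<or> l3 \<noteq> 2)"
      then show False using \<open>l1 \<ge> 2\<close> min par by auto
    qed
    then have "l3 \<ge> 4 \<or> l2 \<ge> 4" using ev assms(3,4) by presburger
    then show ?thesis
    proof
      assume "l3 \<ge> 4"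
      then show ?thesis
        using not_choosable[of "{1, 2}" "{1, 3}" "[{1, 2}]" "[{2, 3}]" "[{1, 2}, {2, 3}, {1, 3}]"]
          theta_sum_2_2_4 assms True par ev \<open>l1 \<ge> 2\<close> by simp
    next
      \<comment> \<open>The same assignment with the second and third paths exchanged.\<close>
      assume "l2 \<ge> 4"
      then show ?thesis
        using not_choosable[of "{1, 2}" "{1, 3}" "[{1, 2}]" "[{1, 2}, {2, 3}, {1, 3}]" "[{2, 3}]"]
          assms True par ev \<open>l1 \<ge> 2\<close> theta_sum_2_2_4[unfolded theta_sum_perm(2)[of _ _ _ "[{2, 3}]"]] by simp
    qed
  qed
qed

end
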